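(* Suppose triangle $ABC$ is $N$-tiled by the tile with sides $(a,b,c)$ and angles $(\alpha,\beta,\gamma)$, where $3\alpha+2\beta=\pi$. Suppose triangle $ABC$ is isosceles with base angles $\alpha+\beta$, and $\alpha\neq\pi/8$. Let $s=a/c$, and let $M$ be the coloring number of the tiling. Then $$\frac{N}{M^2}=\frac{1+s}{1-s}.$$ An algebraically equivalent form of the equation is $$s=\frac{N-M^2}{N+M^2}.$$ The scale factor $\mu$ is given by $$\mu=M(1+s).$$
   Context: An $N$-tiling of a triangle $ABC$ by a triangle $T$ (the tile) is a way of writing $ABC$ as a union of $N$ triangles congruent to $T$ (also called tiles; reflections allowed) overlapping only at their boundaries; tiles need not meet edge-to-edge. The sides $a,b,c$ of the tile are opposite its angles $\alpha,\beta,\gamma$ respectively. Coloring number: color the tiles black and white so that any two tiles whose boundaries share a segment of positive length have opposite colors and so that the tile at the apex of $ABC$ (the vertex with angle $\alpha$, where there is just one tile) is black; the coloring number $M$ is the number of black tiles minus the number of white tiles. The scale factor $\mu$ is defined by $X=\mu c$, where $X$ is the common length of the two equal sides of $ABC$; equivalently $Y=\mu a$, where $Y$ is the length of the base. *)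

theory Defs
  imports "HOL-Analysis.Analysis"
begin

text \<open>The Euclidean plane is the type \<^typ>\<open>complex\<close>; triangles are closed filled triangles,
  i.e. convex hulls of three non-collinear points.\<close>

text \<open>The unoriented angle at \<open>q\<close> between the rays towards \<open>p\<close> and \<open>r\<close>; it is only meaningful
  for \<open>p \<noteq> q\<close> and \<open>r \<noteq> q\<close>.\<close>

definition vertex_angle :: "complex \<Rightarrow> complex \<Rightarrow> complex \<Rightarrow> real" where
  "vertex_angle p q r = arccos (((p - q) \<bullet> (r - q)) / (norm (p - q) * norm (r - q)))"

text \<open>Isometries of the plane include the orientation-reversing ones, so reflected copies
  are congruent.\<close>

definition congruent_figures :: "complex set \<Rightarrow> complex set \<Rightarrow> bool" where
  "congruent_figures S T \<longleftrightarrow>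
     (\<exists>f :: complex \<Rightarrow> complex. (\<forall>x y. dist (f x) (f y) = dist x y) \<and> f ` S = T)"

text \<open>Since congruent copies of a non-degenerate triangle have non-empty interior, two copies
  overlapping only at their boundaries are different sets, so a tiling can be represented
  by the set of its tiles.  Tiles need not meet edge-to-edge.\<close>

definition N_tiling :: "nat \<Rightarrow> complex set \<Rightarrow> complex set \<Rightarrow> complex set set \<Rightarrow> bool" where
  "N_tiling N \<Delta> T \<T> \<longleftrightarrow>
     finite \<T> \<and> card \<T> = N \<and>
     (\<forall>t\<in>\<T>. congruent_figures T t) \<and>
     \<Union>\<T> = \<Delta> \<and>
     (\<forall>t\<in>\<T>. \<forall>u\<in>\<T>. t \<noteq> u \<longrightarrow> t \<inter> u \<subseteq> frontier t \<inter> frontier u)"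

datatype color = Black | White

definition share_segment :: "complex set \<Rightarrow> complex set \<Rightarrow> bool" where
  "share_segment t u \<longleftrightarrow>
     (\<exists>p q. p \<noteq> q \<and> closed_segment p q \<subseteq> frontier t \<inter> frontier u)"

text \<open>Here \<open>A\<close> is the apex of the tiled triangle.  Two neighbouring tiles meeting at \<open>A\<close> would
  share a segment and could not both be black, so the last condition forces there to be
  only one tile at \<open>A\<close>.  The values of \<open>col\<close> outside \<open>\<T>\<close> are irrelevant.\<close>

definition tile_coloring :: "complex \<Rightarrow> complex set set \<Rightarrow> (complex set \<Rightarrow> color) \<Rightarrow> bool" where
  "tile_coloring A \<T> col \<longleftrightarrow>
     (\<forall>t\<in>\<T>. \<forall>u\<in>\<T>. t \<noteq> u \<and> share_segment t u \<longrightarrow> col t \<noteq> col u) \<and>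
     (\<forall>t\<in>\<T>. A \<in> t \<longrightarrow> col t = Black)"

definition coloring_number :: "complex set set \<Rightarrow> (complex set \<Rightarrow> color) \<Rightarrow> int" where
  "coloring_number \<T> col =
     int (card {t\<in>\<T>. col t = Black}) - int (card {t\<in>\<T>. col t = White})"

end

(* Let theta = alpha, let (a, b, c) be the tile and h = exp(i (pi + theta) / 2).  The triangle has
   equal sides X enclosing the angle theta and base Y = X s; moreover b = c (1 - s^2), and the angles
   of the tile are, modulo pi, the multiples 2, -3 and 1 of the argument of h.

   If phi is a function on vectors with phi(k z) = k phi(z) for real k, then the sum of phi over the
   counterclockwise boundary is additive under dissection, because both sides of an interior segment
   cancel.  (Formally: compare the lengths of the slices by a line just above and just below a
   horizontal line; the jump of the slice length is the signed length of the horizontal edges.)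

   Measuring edges parallel to AB in this way shows that X is an integer combination of a, b, c, so
   mu is an integer polynomial in s, while comparing areas gives mu^2 = N (1 - s^2).  If theta / pi
   were rational, then s = 2 sin(theta / 2) would be a totally real algebraic integer, and the last
   equation would hold for all its conjugates, which would therefore lie in [-1, 1].  As 0 < s < 1,
   the norm of s would be a nonzero integer of absolute value less than 1.

   So theta / pi is irrational, and phi(k h^n AB) = k (-1)^n |AB| (and 0 in other directions) is well
   defined.  The boundary sum of a tile is kappa (a + b + c) with kappa in {-1, 0, 1}, and that of the
   triangle is 2 X - Y.  Tiles sharing a segment have opposite kappa; since tiles sharing no segment
   meet in at most one point, any two tiles are linked by shared segments.  By irrationality a single
   tile lies at the apex, with kappa = 1.  Hence kappa is the coloring and M (a + b + c) = 2 X - Y,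
   that is mu = M (1 + s). *)
theory Submission
  imports Defs "HOL-Computational_Algebra.Fundamental_Theorem_Algebra"
begin

section \<open>Triangles and their horizontal slices\<close>

text \<open>The weights (-1)^n are dictated by exterior angles. Put h =
  \<open>cis (turn \<theta>)\<close>. Along the counterclockwise boundary of a tile the edge
  direction gets multiplied, at the three vertices, by h^(-2), -h^3 and -h^(-1): a minus sign comes
  exactly with an odd exponent. So an odd function that changes sign under multiplication by h is
  constant along the boundary of a tile, and reflected tiles behave alike because only their
  interior angles matter. At either base vertex of the big triangle the factor is h itself, without
  a minus sign; hence the base is counted against the equal sides.

  The obstacle is consistency: if some odd power of h were a positive real number, one direction
  would receive both weights. Irrationality must therefore come first, and it has to be extracted
  from the tiling itself, by an edge count in a single direction that needs no weights.\<close>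

definition orient :: "complex \<Rightarrow> complex \<Rightarrow> complex \<Rightarrow> real" where
  "orient p q r = Im (cnj (q - p) * (r - p))"

lemma orient_eq: "orient p q r = (Re q - Re p) * (Im r - Im p) - (Im q - Im p) * (Re r - Re p)"
  by (simp add: orient_def algebra_simps)

lemma orient_rotate: "orient q r p = orient p q r"
  by (simp add: orient_eq algebra_simps)

lemma orient_swap: "orient p r q = - orient p q r"
  by (simp add: orient_eq algebra_simps)

lemma orient_mult: "orient (w * p) (w * q) (w * r) = (norm w)\<^sup>2 * orient p q r"
  by (simp add: orient_eq cmod_power2) algebra

text \<open>Heron's formula, as \<open>orient\<close> is twice the signed area. It shows that the
  three distances alone decide nondegeneracy.\<close>

lemma orient_square:
  "(orient p q r)\<^sup>2 =
    (dist p q)\<^sup>2 * (dist p r)\<^sup>2 - (((dist p q)\<^sup>2 + (dist p r)\<^sup>2 - (dist q r)\<^sup>2) / 2)\<^sup>2"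
  unfolding dist_norm cmod_power2 orient_eq by (simp add: power2_eq_square field_simps)

lemma orient_zero_collinear:
  assumes "orient p q r = 0"
  shows "collinear {p, q, r}"
proof (cases "q = p")
  case False
  have "(r - p) / (q - p) \<in> \<real>"
    using assms False by (simp add: complex_is_Real_iff orient_def Im_divide' Im_complex_div_eq_0
      cmod_def algebra_simps)
  then have "collinear {0, q - p, r - p}"
    by (simp add: collinear_iff_Reals)
  then have "collinear {q, p, r}"
    by (simp add: collinear_3)
  then show ?thesis
    by (simp add: insert_commute)
qed auto

lemma collinear_orient_zero:
  assumes "collinear {p, q, r}"
  shows "orient p q r = 0"
proof -
  have "collinear {q, p, r}"
    using assms by (simp add: insert_commute)
  then have "collinear {0, q - p, r - p}"
    by (simp add: collinear_3)
  then have "(r - p) / (q - p) \<in> \<real>"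
    by (simp add: collinear_iff_Reals)
  then show ?thesis
    by (cases "q = p") (auto simp: complex_is_Real_iff orient_def Im_divide' Im_complex_div_eq_0
      cmod_def algebra_simps)
qed

definition tri :: "complex \<Rightarrow> complex \<Rightarrow> complex \<Rightarrow> complex set" where
  "tri p q r = convex hull {p, q, r}"

lemma tri_rotate: "tri q r p = tri p q r"
  by (simp add: tri_def insert_commute)

lemma tri_swap: "tri p r q = tri p q r"
  by (simp add: tri_def insert_commute)

lemma convex_tri [simp]: "convex (tri p q r)"
  by (simp add: tri_def)

lemma compact_tri [simp]: "compact (tri p q r)"
  by (simp add: tri_def compact_convex_hull)

lemma closed_tri [simp]: "closed (tri p q r)"
  by (simp add: compact_imp_closed)

lemma tri_vertices [simp]: "p \<in> tri p q r" "q \<in> tri p q r" "r \<in> tri p q r"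
  by (auto simp: tri_def hull_inc)

lemma frontier_tri:
  "frontier (tri p q r) = closed_segment p q \<union> closed_segment q r \<union> closed_segment r p"
  unfolding tri_def by (rule frontier_of_triangle) simp

lemma tri_image_mult: "(\<lambda>z. w * z) ` tri p q r = tri (w * p) (w * q) (w * r)"
  unfolding tri_def by (simp add: convex_hull_linear_image bounded_linear.linear bounded_linear_mult_right)

text \<open>Divided by \<open>orient p q r\<close>, the three orientations are the barycentric
  coordinates of \<open>z\<close>.\<close>

lemma tri_barycentric:
  assumes "orient p q r > 0"
  shows "z \<in> tri p q r \<longleftrightarrow> 0 \<le> orient p q z \<and> 0 \<le> orient q r z \<and> 0 \<le> orient r p z"
proof
  assume "z \<in> tri p q r"
  then obtain u v w where *: "0 \<le> u" "0 \<le> v" "0 \<le> w" "u + v + w = 1" "z = u *\<^sub>R p + v *\<^sub>R q + w *\<^sub>R r"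
    by (auto simp: tri_def convex_hull_3)
  have u: "u = 1 - v - w" using * by simp
  have "orient p q z = w * orient p q r" "orient q r z = u * orient p q r" "orient r p z = v * orient p q r"
    unfolding *(5) orient_eq u by (simp_all add: algebra_simps)
  then show "0 \<le> orient p q z \<and> 0 \<le> orient q r z \<and> 0 \<le> orient r p z"
    using * assms by simp
next
  assume *: "0 \<le> orient p q z \<and> 0 \<le> orient q r z \<and> 0 \<le> orient r p z"
  define D where "D = orient p q r"
  have D: "D > 0" using assms by (simp add: D_def)
  have s: "orient p q z + orient q r z + orient r p z = D"
    unfolding D_def orient_eq by (simp add: algebra_simps)
  have "D * Re z = orient q r z * Re p + orient r p z * Re q + orient p q z * Re r"
       "D * Im z = orient q r z * Im p + orient r p z * Im q + orient p q z * Im r"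
    unfolding D_def orient_eq by (simp_all add: algebra_simps)
  then have "z = (orient q r z / D) *\<^sub>R p + (orient r p z / D) *\<^sub>R q + (orient p q z / D) *\<^sub>R r"
    using D by (simp add: complex_eq_iff field_simps)
  moreover have "orient q r z / D + orient r p z / D + orient p q z / D = 1"
    using s D by (simp add: field_simps)
  moreover have "0 \<le> orient q r z / D" "0 \<le> orient r p z / D" "0 \<le> orient p q z / D"
    using * D by simp_all
  ultimately show "z \<in> tri p q r"
    unfolding tri_def convex_hull_3 by blast
qed

lemma continuous_orient [continuous_intros]:
  "continuous_on S (orient p q)"
  unfolding orient_def by (intro continuous_intros)

lemma interior_triI:
  assumes "orient p q r > 0" "orient p q z > 0" "orient q r z > 0" "orient r p z > 0"
  shows "z \<in> interior (tri p q r)"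
proof (rule interiorI)
  let ?U = "{z. orient p q z > 0} \<inter> {z. orient q r z > 0} \<inter> {z. orient r p z > 0}"
  show "open ?U"
    by (intro open_Int open_Collect_less continuous_intros)
  show "z \<in> ?U" using assms by auto
  show "?U \<subseteq> tri p q r" using assms(1) by (auto simp: tri_barycentric)
qed

section \<open>Slice lengths as signed sums over the edges\<close>

definition slice :: "complex set \<Rightarrow> real \<Rightarrow> real set" where
  "slice S y = {x. Complex x y \<in> S}"

definition edge_x :: "complex \<Rightarrow> complex \<Rightarrow> real \<Rightarrow> real" where
  "edge_x p q y = Re p + (y - Im p) * (Re q - Re p) / (Im q - Im p)"

text \<open>Counterclockwise, the right-hand boundary rises and the left-hand one falls, so signed
  abscissas add up to right end minus left end of the slice. Horizontal edges give 0. So do endpoint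
  heights, a default that does no harm because the heights of vertices are always avoided or form a
  finite set.\<close>

definition edge_term :: "complex \<Rightarrow> complex \<Rightarrow> real \<Rightarrow> real" where
  "edge_term p q y =
    (if Im p < y \<and> y < Im q then edge_x p q y
     else if Im q < y \<and> y < Im p then - edge_x p q y else 0)"

definition slice_sum :: "complex \<Rightarrow> complex \<Rightarrow> complex \<Rightarrow> real \<Rightarrow> real" where
  "slice_sum p q r y = edge_term p q y + edge_term q r y + edge_term r p y"

lemma slice_sum_rotate: "slice_sum q r p = slice_sum p q r"
  by (auto simp: slice_sum_def)

lemma edge_x_swap:
  assumes "Im p \<noteq> Im q"
  shows "edge_x q p y = edge_x p q y"
  using assms unfolding edge_x_def by (simp add: divide_simps) (simp add: algebra_simps)

lemma edge_x_in_segment: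
  assumes "(Im p - y) * (Im q - y) < 0"
  shows "Complex (edge_x p q y) y \<in> closed_segment p q"
proof -
  define u where "u = (y - Im p) / (Im q - Im p)"
  have ne: "Im q - Im p \<noteq> 0"
  proof
    assume "Im q - Im p = 0"
    then have "(Im p - y) * (Im q - y) = (Im p - y)\<^sup>2" by (simp add: power2_eq_square)
    then show False using assms by (metis not_less zero_le_power2)
  qed
  have u: "0 \<le> u" "u \<le> 1"
    using assms ne unfolding u_def by (auto simp: mult_less_0_iff divide_simps)
  have "Complex (edge_x p q y) y = (1 - u) *\<^sub>R p + u *\<^sub>R q"
    using ne unfolding complex_eq_iff edge_x_def u_def
    by (auto simp: divide_simps) (auto simp: algebra_simps)
  then show ?thesis
    using u by (auto simp: in_segment)
qed

lemma slice_tri_segment: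
  assumes "(Im p - y) * (Im q - y) < 0" "(Im p - y) * (Im r - y) < 0"
  shows "slice (tri p q r) y = closed_segment (edge_x p q y) (edge_x p r y)"
proof
  show "slice (tri p q r) y \<subseteq> closed_segment (edge_x p q y) (edge_x p r y)"
  proof
    fix x assume "x \<in> slice (tri p q r) y"
    then obtain u v w where *: "0 \<le> u" "0 \<le> v" "0 \<le> w" "u + v + w = 1"
      "Complex x y = u *\<^sub>R p + v *\<^sub>R q + w *\<^sub>R r"
      by (auto simp: slice_def tri_def convex_hull_3)
    have u: "u = 1 - v - w" using * by simp
    have x: "x = Re p + v * (Re q - Re p) + w * (Re r - Re p)"
      and y: "Im p - y = v * (Im p - Im q) + w * (Im p - Im r)"
      using *(5) by (auto simp: complex_eq_iff u algebra_simps)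
    define D where "D = Im p - y"
    have D: "D \<noteq> 0" using assms by (auto simp: D_def)
    have nz: "Im q - Im p \<noteq> 0" "Im r - Im p \<noteq> 0"
      using assms by (auto simp: mult_less_0_iff)
    \<comment> \<open>The drop \<open>D\<close> from \<open>p\<close> to the line splits into a
      share caused by \<open>q\<close> and one caused by \<open>r\<close>; the relative share of
      \<open>r\<close> is the position on the slice.\<close>
    define l where "l = w * (Im p - Im r) / D"
    have l1: "1 - l = v * (Im p - Im q) / D"
      using y D unfolding l_def by (simp add: D_def field_simps)
    have "0 \<le> (Im p - Im r) / D" "0 \<le> (Im p - Im q) / D"
      using assms unfolding D_def by (auto simp: mult_less_0_iff zero_le_divide_iff)
    then have pos: "0 \<le> l" "0 \<le> 1 - l"
      using mult_nonneg_nonneg [OF \<open>0 \<le> w\<close> \<open>0 \<le> (Im p - Im r) / D\<close>]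
        mult_nonneg_nonneg [OF \<open>0 \<le> v\<close> \<open>0 \<le> (Im p - Im q) / D\<close>]
      unfolding l1 unfolding l_def by simp_all
    have ex: "edge_x p q y = Re p + D * (Re q - Re p) / (Im p - Im q)"
      "edge_x p r y = Re p + D * (Re r - Re p) / (Im p - Im r)"
      using nz unfolding edge_x_def D_def by (simp_all add: divide_simps) (simp_all add: algebra_simps)
    have "x = (1 - l) * edge_x p q y + l * edge_x p r y"
    proof -
      have "(1 - l) * edge_x p q y + l * edge_x p r y
        = Re p + (1 - l) * (D * (Re q - Re p) / (Im p - Im q)) + l * (D * (Re r - Re p) / (Im p - Im r))"
        unfolding ex by (simp add: algebra_simps)
      also have "(1 - l) * (D * (Re q - Re p) / (Im p - Im q)) = v * (Re q - Re p)"
        unfolding l1 using D nz by (simp add: divide_simps)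
      also have "l * (D * (Re r - Re p) / (Im p - Im r)) = w * (Re r - Re p)"
        unfolding l_def using D nz by (simp add: divide_simps)
      finally show ?thesis using x by simp
    qed
    then show "x \<in> closed_segment (edge_x p q y) (edge_x p r y)"
      using pos by (auto simp: in_segment)
  qed
  have "Complex (edge_x p q y) y \<in> tri p q r"
    using edge_x_in_segment [OF assms(1)] closed_segment_subset [of p "tri p q r" q] by auto
  moreover have "Complex (edge_x p r y) y \<in> tri p q r"
    using edge_x_in_segment [OF assms(2)] closed_segment_subset [of p "tri p q r" r] by auto
  ultimately have sub: "closed_segment (Complex (edge_x p q y) y) (Complex (edge_x p r y) y) \<subseteq> tri p q r"
    by (simp add: closed_segment_subset)
  show "closed_segment (edge_x p q y) (edge_x p r y) \<subseteq> slice (tri p q r) y"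
  proof
    fix x assume "x \<in> closed_segment (edge_x p q y) (edge_x p r y)"
    then obtain u where "0 \<le> u" "u \<le> 1" "x = (1 - u) * edge_x p q y + u * edge_x p r y"
      by (auto simp: in_segment)
    then have "Complex x y \<in> closed_segment (Complex (edge_x p q y) y) (Complex (edge_x p r y) y)"
      unfolding in_segment by (intro exI[of _ u]) (auto simp: complex_eq_iff algebra_simps)
    then show "x \<in> slice (tri p q r) y"
      using sub by (auto simp: slice_def)
  qed
qed

text \<open>The difference of the two crossing points is a positive multiple of
  \<open>(y - Im p) * orient p q r\<close>, so the orientation puts them in the order that the signs
  of \<open>edge_term\<close> expect. The third edge is not crossed.\<close>

lemma measure_slice_tri_apex:
  assumes "(Im p - y) * (Im q - y) < 0" "(Im p - y) * (Im r - y) < 0" "orient p q r > 0"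
  shows "measure lborel (slice (tri p q r) y) = slice_sum p q r y"
proof -
  have nz: "Im q - Im p \<noteq> 0" "Im r - Im p \<noteq> 0"
    using assms by (auto simp: mult_less_0_iff)
  have pos: "(Im q - Im p) * (Im r - Im p) > 0"
    using assms by (auto simp: mult_less_0_iff zero_less_mult_iff)
  have "edge_x p q y - edge_x p r y = (y - Im p) * ((Re q - Re p) / (Im q - Im p) - (Re r - Re p) / (Im r - Im p))"
    unfolding edge_x_def by (simp add: algebra_simps)
  also have "(Re q - Re p) / (Im q - Im p) - (Re r - Re p) / (Im r - Im p) = orient p q r / ((Im q - Im p) * (Im r - Im p))"
    using nz unfolding orient_eq by (simp add: divide_simps algebra_simps)
  finally have diff: "edge_x p q y - edge_x p r y = (y - Im p) * (orient p q r / ((Im q - Im p) * (Im r - Im p)))" .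
  have quot: "orient p q r / ((Im q - Im p) * (Im r - Im p)) > 0"
    using assms(3) pos by simp
  have m: "measure lborel (slice (tri p q r) y) = \<bar>edge_x p q y - edge_x p r y\<bar>"
    unfolding slice_tri_segment [OF assms(1,2)] closed_segment_eq_real_ivl by auto
  consider "Im p < y" "y < Im q" "y < Im r" | "y < Im p" "Im q < y" "Im r < y"
    using assms by (auto simp: mult_less_0_iff)
  then show ?thesis
  proof cases
    case 1
    then have "0 < edge_x p q y - edge_x p r y" unfolding diff using quot by (intro mult_pos_pos) simp_all
    then show ?thesis unfolding m slice_sum_def edge_term_def using 1 edge_x_swap [of p r y] by simp
  next
    case 2
    then have "edge_x p q y - edge_x p r y < 0" unfolding diff using quot by (intro mult_neg_pos) simp_all
    then show ?thesis unfolding m slice_sum_def edge_term_def using 2 edge_x_swap [of p r y] by simp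
  qed
qed

lemma slice_tri_empty:
  assumes "Im p < y \<and> Im q < y \<and> Im r < y \<or> y < Im p \<and> y < Im q \<and> y < Im r"
  shows "slice (tri p q r) y = {}"
proof -
  have "convex {z. Im z < y}" "convex {z. Im z > y}"
    using convex_halfspace_Im_lt convex_halfspace_Im_gt by auto
  then have "{p, q, r} \<subseteq> {z. Im z < y} \<Longrightarrow> tri p q r \<subseteq> {z. Im z < y}"
    "{p, q, r} \<subseteq> {z. Im z > y} \<Longrightarrow> tri p q r \<subseteq> {z. Im z > y}"
    unfolding tri_def by (simp_all add: hull_minimal)
  then have "tri p q r \<subseteq> {z. Im z < y} \<or> tri p q r \<subseteq> {z. Im z > y}"
    using assms by auto
  then show ?thesis by (auto simp: slice_def)
qed

lemma measure_slice_tri: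
  assumes "y \<noteq> Im p" "y \<noteq> Im q" "y \<noteq> Im r" "orient p q r > 0"
  shows "measure lborel (slice (tri p q r) y) = slice_sum p q r y"
proof -
  \<comment> \<open>A line through no vertex misses the triangle or cuts off exactly one vertex;
    cyclic symmetry brings that vertex to the front.\<close>
  consider "Im p < y \<and> Im q < y \<and> Im r < y \<or> y < Im p \<and> y < Im q \<and> y < Im r"
    | "(Im p - y) * (Im q - y) < 0" "(Im p - y) * (Im r - y) < 0"
    | "(Im q - y) * (Im r - y) < 0" "(Im q - y) * (Im p - y) < 0"
    | "(Im r - y) * (Im p - y) < 0" "(Im r - y) * (Im q - y) < 0"
  proof -
    have "Im p < y \<or> y < Im p" "Im q < y \<or> y < Im q" "Im r < y \<or> y < Im r"
      using assms by linarith+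
    then have "(Im p < y \<and> Im q < y \<and> Im r < y \<or> y < Im p \<and> y < Im q \<and> y < Im r) \<or>
        ((Im p - y) * (Im q - y) < 0 \<and> (Im p - y) * (Im r - y) < 0) \<or>
        ((Im q - y) * (Im r - y) < 0 \<and> (Im q - y) * (Im p - y) < 0) \<or>
        ((Im r - y) * (Im p - y) < 0 \<and> (Im r - y) * (Im q - y) < 0)"
      unfolding mult_less_0_iff diff_less_0_iff_less diff_gt_0_iff_gt by argo
    then show thesis
      using that by blast
  qed
  then show ?thesis
  proof cases
    case 1
    then show ?thesis
      unfolding slice_tri_empty [OF 1] by (auto simp: slice_sum_def edge_term_def)
  next
    case 2
    then show ?thesis by (intro measure_slice_tri_apex assms)
  next
    case 3
    have "orient q r p = orient p q r" "tri q r p = tri p q r" "slice_sum q r p = slice_sum p q r"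
      by (rule orient_rotate tri_rotate slice_sum_rotate)+
    then show ?thesis
      using measure_slice_tri_apex [of q y r p] 3 assms(4) by simp
  next
    case 4
    have "orient r p q = orient p q r" "tri r p q = tri p q r" "slice_sum r p q = slice_sum p q r"
      by (rule orient_rotate [symmetric] tri_rotate [symmetric] slice_sum_rotate [symmetric])+
    then show ?thesis
      using measure_slice_tri_apex [of r y p q] 4 assms(4) by simp
  qed
qed

section \<open>Additivity of boundary sums\<close>

lemma finite_slice_segment:
  assumes "y \<noteq> Im p"
  shows "finite (slice (closed_segment p q) y)"
proof (rule finite_subset)
  show "slice (closed_segment p q) y \<subseteq> {edge_x p q y}"
  proof
    fix x assume "x \<in> slice (closed_segment p q) y"
    then obtain u where u: "x = (1 - u) * Re p + u * Re q" "y = (1 - u) * Im p + u * Im q"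
      by (auto simp: slice_def in_segment complex_eq_iff)
    have ne: "Im q - Im p \<noteq> 0"
      using assms u(2) by (auto simp: algebra_simps)
    have "y - Im p = u * (Im q - Im p)"
      unfolding u(2) by (simp add: algebra_simps)
    then have "edge_x p q y = Re p + u * (Re q - Re p)"
      unfolding edge_x_def using ne by simp
    then show "x \<in> {edge_x p q y}"
      unfolding u(1) by (simp add: algebra_simps)
  qed
qed simp

lemma finite_slice_frontier_tri:
  assumes "y \<noteq> Im p" "y \<noteq> Im q" "y \<noteq> Im r"
  shows "finite (slice (frontier (tri p q r)) y)"
proof -
  have "slice (frontier (tri p q r)) y = slice (closed_segment p q) y
      \<union> slice (closed_segment q r) y \<union> slice (closed_segment r p) y"
    by (auto simp: frontier_tri slice_def)
  then show ?thesis
    by (simp add: finite_slice_segment assms)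
qed

lemma compact_slice_tri: "compact (slice (tri p q r) y)"
proof -
  have "closed ((\<lambda>x. Complex x y) -` tri p q r)"
    by (intro continuous_closed_vimage) (auto simp: Complex_eq intro!: continuous_intros)
  moreover have "slice (tri p q r) y = (\<lambda>x. Complex x y) -` tri p q r"
    by (auto simp: slice_def)
  moreover have "bounded (slice (tri p q r) y)"
  proof -
    obtain K where K: "\<And>z. z \<in> tri p q r \<Longrightarrow> norm z \<le> K"
      using compact_imp_bounded [OF compact_tri] unfolding bounded_iff by blast
    have "\<bar>x\<bar> \<le> K" if "x \<in> slice (tri p q r) y" for x
      using K [of "Complex x y"] abs_Re_le_cmod [of "Complex x y"] that by (auto simp: slice_def)
    then show ?thesis unfolding bounded_iff real_norm_def by blast
  qed
  ultimately show ?thesis by (simp add: compact_eq_bounded_closed)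
qed

lemma measure_lebesgue_slice_tri:
  assumes "y \<noteq> Im p" "y \<noteq> Im q" "y \<noteq> Im r" "orient p q r > 0"
  shows "measure lebesgue (slice (tri p q r) y) = slice_sum p q r y"
  using measure_slice_tri [OF assms] compact_slice_tri [of p q r y]
  by (simp add: measure_completion borel_compact)

text \<open>Each piece carries a counterclockwise order of its vertices, because boundary sums
  depend on it. The pieces may be arbitrary triangles and the position is free, so a rotated
  dissection is again an instance.\<close>

locale triangle_dissection =
  fixes I :: "'i set" and p q r :: "'i \<Rightarrow> complex" and A B C :: complex
  assumes finite_index: "finite I"
    and orient_pos: "i \<in> I \<Longrightarrow> orient (p i) (q i) (r i) > 0"
    and outer_orient_pos: "orient A B C > 0"
    and cover: "(\<Union>i\<in>I. tri (p i) (q i) (r i)) = tri A B C"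
    and overlap: "i \<in> I \<Longrightarrow> j \<in> I \<Longrightarrow> i \<noteq> j \<Longrightarrow>
      tri (p i) (q i) (r i) \<inter> tri (p j) (q j) (r j) \<subseteq> frontier (tri (p i) (q i) (r i))"
begin

definition heights :: "real set" where
  "heights = (\<Union>i\<in>I. {Im (p i), Im (q i), Im (r i)}) \<union> {Im A, Im B, Im C}"

lemma finite_heights: "finite heights"
  using finite_index by (simp add: heights_def)

text \<open>A line through no vertex meets each frontier in finitely many points, so the slices of
  two pieces overlap in a null set and their lengths add.\<close>

lemma slice_sum_additive:
  assumes "y \<notin> heights"
  shows "slice_sum A B C y = (\<Sum>i\<in>I. slice_sum (p i) (q i) (r i) y)"
proof -
  let ?S = "\<lambda>i. slice (tri (p i) (q i) (r i)) y"
  have "slice_sum A B C y = measure lebesgue (slice (tri A B C) y)"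
    using assms outer_orient_pos by (intro measure_lebesgue_slice_tri [symmetric]) (auto simp: heights_def)
  also have "slice (tri A B C) y = \<Union> (?S ` I)"
    unfolding cover [symmetric] by (auto simp: slice_def)
  also have "measure lebesgue (\<Union> (?S ` I)) = (\<Sum>i\<in>I. measure lebesgue (?S i))"
  proof (rule measure_negligible_finite_Union_image)
    show "finite I" by (rule finite_index)
    show "?S i \<in> lmeasurable" for i
      by (rule lmeasurable_compact [OF compact_slice_tri])
    show "pairwise (\<lambda>i j. negligible (?S i \<inter> ?S j)) I"
    proof (rule pairwiseI)
      fix i j assume ij: "i \<in> I" "j \<in> I" "i \<noteq> j"
      have "?S i \<inter> ?S j \<subseteq> slice (frontier (tri (p i) (q i) (r i))) y"
        using overlap [OF ij] by (auto simp: slice_def)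
      moreover have "finite (slice (frontier (tri (p i) (q i) (r i))) y)"
        using assms ij(1) by (intro finite_slice_frontier_tri) (auto simp: heights_def)
      ultimately show "negligible (?S i \<inter> ?S j)"
        using finite_subset negligible_finite by blast
    qed
  qed
  also have "\<dots> = (\<Sum>i\<in>I. slice_sum (p i) (q i) (r i) y)"
    using assms orient_pos by (intro sum.cong measure_lebesgue_slice_tri) (auto simp: heights_def)
  finally show ?thesis .
qed

end

section \<open>The jump of the slice length at a given height\<close>

definition horizontal_at :: "complex \<Rightarrow> complex \<Rightarrow> real \<Rightarrow> real" where
  "horizontal_at p q y = (if Im p = y \<and> Im q = y then Re q - Re p else 0)"

text \<open>Correction at an endpoint of an edge; around a triangle these terms telescope.\<close>

definition vertex_at :: "complex \<Rightarrow> real \<Rightarrow> real" where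
  "vertex_at p y = (if Im p = y then Re p else 0)"

lemma edge_term_swap: "edge_term q p y = - edge_term p q y"
  using edge_x_swap [of p q y] by (auto simp: edge_term_def)

lemma edge_x_tendsto:
  "((\<lambda>e. edge_x p q (y + e)) \<longlongrightarrow> edge_x p q y) (at_right 0)"
  "((\<lambda>e. edge_x p q (y - e)) \<longlongrightarrow> edge_x p q y) (at_right 0)"
proof -
  have "((\<lambda>e. edge_x p q (y + e)) \<longlongrightarrow> edge_x p q (y + 0)) (at_right 0)"
    "((\<lambda>e. edge_x p q (y - e)) \<longlongrightarrow> edge_x p q (y - 0)) (at_right 0)"
    unfolding edge_x_def divide_inverse by (intro tendsto_intros)+
  then show "((\<lambda>e. edge_x p q (y + e)) \<longlongrightarrow> edge_x p q y) (at_right 0)"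
    "((\<lambda>e. edge_x p q (y - e)) \<longlongrightarrow> edge_x p q y) (at_right 0)"
    by simp_all
qed

lemma tendsto_at_right_cong:
  fixes f :: "real \<Rightarrow> real"
  assumes "(g \<longlongrightarrow> l) (at_right 0)" "0 < d" "\<And>e. 0 < e \<Longrightarrow> e < d \<Longrightarrow> f e = g e"
  shows "(f \<longlongrightarrow> l) (at_right 0)"
proof -
  have "eventually (\<lambda>e. g e = f e) (at_right 0)"
    using assms(2,3) by (intro eventually_at_rightI [of 0 d]) auto
  then show ?thesis using assms(1) by (rule Lim_transform_eventually [rotated])
qed

text \<open>Across \<open>y\<close> a rising edge is continuous unless \<open>y\<close> is the
  height of an endpoint: at \<open>p\<close> the term sets in, at \<open>q\<close> it stops.\<close>

lemma edge_jump_up: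
  assumes "Im p < Im q"
  shows "((\<lambda>e. edge_term p q (y + e) - edge_term p q (y - e))
    \<longlongrightarrow> vertex_at p y - vertex_at q y) (at_right 0)"
proof -
  consider "y < Im p" | "y = Im p" | "Im p < y" "y < Im q" | "y = Im q" | "Im q < y"
    by linarith
  then show ?thesis
  proof cases
    case 1
    then show ?thesis
      using assms by - (rule tendsto_at_right_cong [where g = "\<lambda>_. 0" and d = "Im p - y"],
        auto simp: edge_term_def vertex_at_def)
  next
    case 2
    have "edge_x p q y = Re p" by (simp add: edge_x_def 2)
    then show ?thesis
      using assms 2 edge_x_tendsto(1) [of p q y]
      by - (rule tendsto_at_right_cong [where g = "\<lambda>e. edge_x p q (y + e)" and d = "Im q - y"],
        auto simp: edge_term_def vertex_at_def)
  next
    case 3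
    have "((\<lambda>e. edge_x p q (y + e) - edge_x p q (y - e)) \<longlongrightarrow> edge_x p q y - edge_x p q y) (at_right 0)"
      by (intro tendsto_diff edge_x_tendsto)
    then show ?thesis
      using assms 3
      by - (rule tendsto_at_right_cong [where g = "\<lambda>e. edge_x p q (y + e) - edge_x p q (y - e)"
            and d = "min (Im q - y) (y - Im p)"],
        auto simp: edge_term_def vertex_at_def)
  next
    case 4
    have "edge_x p q y = Re q" using assms by (simp add: edge_x_def 4)
    then have "((\<lambda>e. - edge_x p q (y - e)) \<longlongrightarrow> - Re q) (at_right 0)"
      using tendsto_minus [OF edge_x_tendsto(2) [of p q y]] by simp
    then show ?thesis
      using assms 4
      by - (rule tendsto_at_right_cong [where g = "\<lambda>e. - edge_x p q (y - e)" and d = "y - Im p"],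
        auto simp: edge_term_def vertex_at_def)
  next
    case 5
    then show ?thesis
      using assms by - (rule tendsto_at_right_cong [where g = "\<lambda>_. 0" and d = "y - Im q"],
        auto simp: edge_term_def vertex_at_def)
  qed
qed

text \<open>A horizontal edge has no jump of its own; there \<open>horizontal_at\<close> offsets the
  two vertex terms. With this bookkeeping all vertex terms cancel in the sum over a triangle, and
  only horizontal edges remain.\<close>

lemma edge_jump:
  "((\<lambda>e. edge_term p q (y + e) - edge_term p q (y - e))
    \<longlongrightarrow> vertex_at p y - vertex_at q y + horizontal_at p q y) (at_right 0)"
proof (cases "Im p" "Im q" rule: linorder_cases)
  case less
  then have "horizontal_at p q y = 0" by (simp add: horizontal_at_def)
  then show ?thesis using edge_jump_up [OF less] by simp
next
  case equal
  then have "edge_term p q = (\<lambda>_. 0)" by (auto simp: edge_term_def)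
  then show ?thesis using equal by (simp add: horizontal_at_def vertex_at_def)
next
  case greater
  then have "horizontal_at p q y = 0" by (simp add: horizontal_at_def)
  then show ?thesis
    using tendsto_minus [OF edge_jump_up [OF greater, of y]] edge_term_swap [of q p] by simp
qed

lemma slice_sum_jump:
  "((\<lambda>e. slice_sum p q r (y + e) - slice_sum p q r (y - e))
    \<longlongrightarrow> horizontal_at p q y + horizontal_at q r y + horizontal_at r p y) (at_right 0)"
  using tendsto_add [OF tendsto_add [OF edge_jump [of p q y] edge_jump [of q r y]] edge_jump [of r p y]]
  by (simp add: slice_sum_def algebra_simps)

definition horizontal_part :: "complex \<Rightarrow> real" where
  "horizontal_part z = (if Im z = 0 then Re z else 0)"

definition boundary_sum :: "(complex \<Rightarrow> real) \<Rightarrow> complex \<Rightarrow> complex \<Rightarrow> complex \<Rightarrow> real" where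
  "boundary_sum \<phi> p q r = \<phi> (q - p) + \<phi> (r - q) + \<phi> (p - r)"

lemma sum_horizontal_at:
  assumes "finite H" "Im p \<in> H"
  shows "(\<Sum>y\<in>H. horizontal_at p q y) = horizontal_part (q - p)"
proof -
  have "horizontal_at p q y = (if y = Im p then horizontal_part (q - p) else 0)" for y
    by (auto simp: horizontal_at_def horizontal_part_def)
  then show ?thesis using assms by simp
qed

context triangle_dissection
begin

text \<open>Both sides are the limit of the same jump: within distance \<open>d\<close> of
  \<open>y\<close>, only \<open>y\<close> itself can be the height of a vertex, so slice lengths are
  additive just above and just below.\<close>

lemma horizontal_at_additive:
  "horizontal_at A B y + horizontal_at B C y + horizontal_at C A y =
   (\<Sum>i\<in>I. horizontal_at (p i) (q i) y + horizontal_at (q i) (r i) y + horizontal_at (r i) (p i) y)"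
proof (rule tendsto_unique)
  have lim: "((\<lambda>e. \<Sum>i\<in>I. slice_sum (p i) (q i) (r i) (y + e) - slice_sum (p i) (q i) (r i) (y - e)) \<longlongrightarrow>
     (\<Sum>i\<in>I. horizontal_at (p i) (q i) y + horizontal_at (q i) (r i) y + horizontal_at (r i) (p i) y)) (at_right 0)"
    by (intro tendsto_sum slice_sum_jump)
  obtain d where d: "d > 0" "\<And>z. z \<in> heights \<Longrightarrow> z \<noteq> y \<Longrightarrow> d \<le> dist y z"
    using finite_set_avoid [OF finite_heights, of y] by auto
  have eq: "slice_sum A B C (y + e) - slice_sum A B C (y - e) =
      (\<Sum>i\<in>I. slice_sum (p i) (q i) (r i) (y + e) - slice_sum (p i) (q i) (r i) (y - e))"
    if "0 < e" "e < d" for e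
  proof -
    have "y + e \<notin> heights" "y - e \<notin> heights"
      using d(2) [of "y + e"] d(2) [of "y - e"] that by (auto simp: dist_real_def)
    then show ?thesis by (simp add: slice_sum_additive sum_subtractf)
  qed
  show "((\<lambda>e. slice_sum A B C (y + e) - slice_sum A B C (y - e)) \<longlongrightarrow>
     (\<Sum>i\<in>I. horizontal_at (p i) (q i) y + horizontal_at (q i) (r i) y + horizontal_at (r i) (p i) y)) (at_right 0)"
    by (rule tendsto_at_right_cong [OF lim d(1) eq])
qed (simp_all add: slice_sum_jump)

lemma horizontal_part_additive:
  "boundary_sum horizontal_part A B C = (\<Sum>i\<in>I. boundary_sum horizontal_part (p i) (q i) (r i))"
proof -
  have "boundary_sum horizontal_part A B C =
      (\<Sum>y\<in>heights. horizontal_at A B y + horizontal_at B C y + horizontal_at C A y)"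
    unfolding boundary_sum_def sum.distrib
    by (subst (1 2 3) sum_horizontal_at) (auto simp: finite_heights, auto simp: heights_def)
  also have "\<dots> = (\<Sum>i\<in>I. \<Sum>y\<in>heights. horizontal_at (p i) (q i) y + horizontal_at (q i) (r i) y
      + horizontal_at (r i) (p i) y)"
    unfolding horizontal_at_additive by (rule sum.swap)
  also have "\<dots> = (\<Sum>i\<in>I. boundary_sum horizontal_part (p i) (q i) (r i))"
  proof (rule sum.cong [OF refl])
    fix i assume "i \<in> I"
    then have "{Im (p i), Im (q i), Im (r i)} \<subseteq> heights" by (auto simp: heights_def)
    then show "(\<Sum>y\<in>heights. horizontal_at (p i) (q i) y + horizontal_at (q i) (r i) y
      + horizontal_at (r i) (p i) y) = boundary_sum horizontal_part (p i) (q i) (r i)"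
      by (simp add: boundary_sum_def sum.distrib sum_horizontal_at finite_heights)
  qed
  finally show ?thesis .
qed

end

section \<open>Area as the integral of the slice length\<close>

lemma edge_term_has_integral_up:
  assumes "Im p < Im q"
  shows "(edge_term p q has_integral (Im q - Im p) * (Re p + Re q) / 2) UNIV"
proof -
  define k where "k = (Re q - Re p) / (Im q - Im p)"
  have k: "k * (Im q - Im p) = Re q - Re p" using assms by (simp add: k_def)
  have ex: "edge_x p q y = Re p + (y - Im p) * k" for y by (simp add: edge_x_def k_def)
  let ?G = "\<lambda>y. Re p * y + (y - Im p)\<^sup>2 / 2 * k"
  have int: "(edge_x p q has_integral ?G (Im q) - ?G (Im p)) {Im p..Im q}"
    using assms unfolding ex
    by (intro fundamental_theorem_of_calculus)
      (auto intro!: derivative_eq_intros simp: has_real_derivative_iff_has_vector_derivative [symmetric])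
  have "?G (Im q) - ?G (Im p) = (Im q - Im p) * (Re p + (k * (Im q - Im p)) / 2)"
    by (simp add: algebra_simps power2_eq_square)
  then have val: "?G (Im q) - ?G (Im p) = (Im q - Im p) * (Re p + Re q) / 2"
    unfolding k by (simp add: field_simps)
  have "((\<lambda>y. if y \<in> {Im p..Im q} then edge_x p q y else 0)
      has_integral (Im q - Im p) * (Re p + Re q) / 2) UNIV"
    unfolding has_integral_restrict_UNIV using int unfolding val .
  then show ?thesis
    by (rule has_integral_spike_finite [where S = "{Im p, Im q}", rotated 2])
      (use assms in \<open>auto simp: edge_term_def\<close>)
qed

lemma edge_term_has_integral:
  "(edge_term p q has_integral (Im q - Im p) * (Re p + Re q) / 2) UNIV"
proof (cases "Im p" "Im q" rule: linorder_cases)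
  case less
  then show ?thesis by (rule edge_term_has_integral_up)
next
  case equal
  then have "edge_term p q = (\<lambda>_. 0)" by (auto simp: edge_term_def)
  then show ?thesis using equal by simp
next
  case greater
  have "edge_term p q = (\<lambda>y. - edge_term q p y)" by (rule ext) (rule edge_term_swap)
  then show ?thesis
    using has_integral_neg [OF edge_term_has_integral_up [OF greater]]
    by (simp add: algebra_simps minus_divide_left)
qed

text \<open>The trapezoids under the three edges add up to the shoelace formula.\<close>

lemma slice_sum_has_integral: "(slice_sum p q r has_integral orient p q r / 2) UNIV"
proof -
  have "((\<lambda>y. edge_term p q y + edge_term q r y + edge_term r p y) has_integral
     (Im q - Im p) * (Re p + Re q) / 2 + (Im r - Im q) * (Re q + Re r) / 2 + (Im p - Im r) * (Re r + Re p) / 2) UNIV"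
    by (intro has_integral_add edge_term_has_integral)
  moreover have "(Im q - Im p) * (Re p + Re q) / 2 + (Im r - Im q) * (Re q + Re r) / 2
      + (Im p - Im r) * (Re r + Re p) / 2 = orient p q r / 2"
    unfolding orient_eq by (simp add: field_simps)
  moreover have "slice_sum p q r = (\<lambda>y. edge_term p q y + edge_term q r y + edge_term r p y)"
    by (simp add: fun_eq_iff slice_sum_def)
  ultimately show ?thesis by simp
qed

context triangle_dissection
begin

lemma orient_additive: "orient A B C = (\<Sum>i\<in>I. orient (p i) (q i) (r i))"
proof -
  have "((\<lambda>y. \<Sum>i\<in>I. slice_sum (p i) (q i) (r i) y) has_integral (\<Sum>i\<in>I. orient (p i) (q i) (r i) / 2)) UNIV"
    by (intro has_integral_sum finite_index slice_sum_has_integral)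
  then have "(slice_sum A B C has_integral (\<Sum>i\<in>I. orient (p i) (q i) (r i) / 2)) UNIV"
    by (rule has_integral_spike_finite [OF finite_heights, rotated]) (auto simp: slice_sum_additive)
  then have "orient A B C / 2 = (\<Sum>i\<in>I. orient (p i) (q i) (r i) / 2)"
    using has_integral_unique slice_sum_has_integral by blast
  then show ?thesis by (simp add: sum_divide_distrib [symmetric])
qed

end

section \<open>From horizontal edges to edges of all directions\<close>

lemma frontier_tri_image_mult:
  "(\<lambda>z. w * z) ` frontier (tri p q r) = frontier (tri (w * p) (w * q) (w * r))"
proof -
  have "linear (\<lambda>z. w * z)" by (simp add: bounded_linear.linear bounded_linear_mult_right)
  then show ?thesis
    unfolding frontier_tri image_Un by (simp add: closed_segment_linear_image)
qed

lemma (in triangle_dissection) dissection_mult: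
  assumes "w \<noteq> 0"
  shows "triangle_dissection I (\<lambda>i. w * p i) (\<lambda>i. w * q i) (\<lambda>i. w * r i) (w * A) (w * B) (w * C)"
proof
  have inj: "inj (\<lambda>z. w * z)" using assms by (simp add: inj_on_def)
  show "finite I" by (rule finite_index)
  show "0 < orient (w * p i) (w * q i) (w * r i)" if "i \<in> I" for i
    unfolding orient_mult using orient_pos [OF that] assms by simp
  show "0 < orient (w * A) (w * B) (w * C)"
    unfolding orient_mult using outer_orient_pos assms by simp
  show "(\<Union>i\<in>I. tri (w * p i) (w * q i) (w * r i)) = tri (w * A) (w * B) (w * C)"
    unfolding tri_image_mult [symmetric] cover [symmetric] by (simp add: image_UN)
  show "tri (w * p i) (w * q i) (w * r i) \<inter> tri (w * p j) (w * q j) (w * r j)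
      \<subseteq> frontier (tri (w * p i) (w * q i) (w * r i))" if "i \<in> I" "j \<in> I" "i \<noteq> j" for i j
    using image_mono [OF overlap [OF that], of "\<lambda>z. w * z"]
    by (simp only: tri_image_mult frontier_tri_image_mult image_Int [OF inj])
qed

definition real_homogeneous :: "(complex \<Rightarrow> real) \<Rightarrow> bool" where
  "real_homogeneous \<phi> \<longleftrightarrow> (\<forall>k z. \<phi> (of_real k * z) = k * \<phi> z)"

text \<open>A canonical unit vector on the line through 0 and \<open>z\<close>, the same for
  \<open>z\<close> and \<open>- z\<close>: it lies in the open upper half-plane or is 1.\<close>

definition line_rep :: "complex \<Rightarrow> complex" where
  "line_rep z = (if Im z > 0 \<or> Im z = 0 \<and> Re z > 0 then sgn z else - sgn z)"

text \<open>Multiplication by \<open>cnj (line_rep z)\<close> turns the line of \<open>z\<close>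
  onto the real axis, where \<open>horizontal_part\<close> reads off a signed length.\<close>

lemma horizontal_part_line_rep:
  assumes "real_homogeneous \<phi>" "z \<noteq> 0"
  shows "\<phi> (line_rep z) * horizontal_part (cnj (line_rep z) * z) = \<phi> z"
proof -
  have n: "norm z \<noteq> 0" using assms by simp
  have s: "cnj (sgn z) * z = of_real (norm z)"
    using n by (simp add: sgn_div_norm scaleR_conv_of_real mult.commute complex_norm_square [symmetric]
      power2_eq_square field_simps)
  have h: "horizontal_part (of_real x) = x" for x by (simp add: horizontal_part_def)
  have z: "of_real (norm z) * sgn z = z"
    using n by (simp add: sgn_div_norm scaleR_conv_of_real field_simps)
  have "\<phi> z = norm z * \<phi> (sgn z)"
    using assms(1) z unfolding real_homogeneous_def by metis
  moreover have "\<phi> (- sgn z) = - \<phi> (sgn z)"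
    using assms(1) [unfolded real_homogeneous_def, rule_format, of "-1" "sgn z"] by simp
  moreover have "horizontal_part (- of_real x) = - x" for x by (simp add: horizontal_part_def)
  ultimately show ?thesis
    unfolding line_rep_def by (simp add: s h)
qed

lemma horizontal_part_line_rep_other:
  assumes "z \<noteq> 0" "z' \<noteq> 0" "line_rep z \<noteq> line_rep z'"
  shows "horizontal_part (cnj (line_rep z') * z) = 0"
proof (rule ccontr)
  define d where "d = line_rep z'"
  assume "horizontal_part (cnj (line_rep z') * z) \<noteq> 0"
  then have im: "Im (cnj d * z) = 0" by (auto simp: horizontal_part_def d_def split: if_splits)
  define k where "k = Re (cnj d * z)"
  have k: "cnj d * z = of_real k" using im by (simp add: k_def complex_eq_iff)
  have sg: "norm (sgn z') = 1" using assms(2) by (simp add: norm_sgn)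
  have nd: "norm d = 1" using sg by (simp add: d_def line_rep_def)
  have "d * cnj d = 1" using nd by (simp add: complex_norm_square [symmetric])
  then have zd: "z = of_real k * d"
    using k by (metis mult.assoc mult.commute mult_1)
  have k0: "k \<noteq> 0" using zd assms by auto
  have dpos: "Im d > 0 \<or> Im d = 0 \<and> Re d > 0"
  proof -
    have "sgn z' = inverse (norm z') *\<^sub>R z'" by (simp add: sgn_div_norm)
    then have "Re (sgn z') = inverse (norm z') * Re z'" "Im (sgn z') = inverse (norm z') * Im z'"
      by (simp_all only: scaleR_complex.sel)
    moreover have "inverse (norm z') > 0" using assms by simp
    moreover have "\<not> (Im z' = 0 \<and> Re z' = 0)" using assms(2) complex_eq_iff [of z' 0] by auto
    ultimately show ?thesis unfolding d_def line_rep_def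
      by (auto simp: zero_less_mult_iff mult_less_0_iff not_less)
  qed
  have sz: "sgn z = of_real (sgn k) * d"
  proof -
    have "sgn d = d" using nd by (simp add: sgn_div_norm)
    then show ?thesis unfolding zd by (simp only: sgn_mult sgn_of_real)
  qed
  have "line_rep z = d"
    using k0 dpos sz zd unfolding line_rep_def
    by (cases "k > 0") (auto simp: zero_less_mult_iff mult_less_0_iff not_less)
  then show False using assms(3) by (simp add: d_def)
qed

lemma real_homogeneous_decompose:
  assumes "real_homogeneous \<phi>" "finite D" "z \<noteq> 0" "line_rep z \<in> D" "D \<subseteq> line_rep ` (- {0})"
  shows "\<phi> z = (\<Sum>d\<in>D. \<phi> d * horizontal_part (cnj d * z))"
proof -
  have "\<phi> d * horizontal_part (cnj d * z) = (if d = line_rep z then \<phi> z else 0)" if "d \<in> D" for d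
  proof -
    obtain z' where "d = line_rep z'" "z' \<noteq> 0" using \<open>d \<in> D\<close> assms(5) by auto
    then show ?thesis
      using horizontal_part_line_rep [OF assms(1,3)] horizontal_part_line_rep_other [OF assms(3), of z'] by auto
  qed
  then have "(\<Sum>d\<in>D. \<phi> d * horizontal_part (cnj d * z)) = (\<Sum>d\<in>D. if d = line_rep z then \<phi> z else 0)"
    by (intro sum.cong) auto
  then show ?thesis using assms by simp
qed

lemma orient_nonzero_distinct:
  assumes "orient p q r \<noteq> 0"
  shows "q - p \<noteq> 0" "r - q \<noteq> 0" "p - r \<noteq> 0"
  using assms by (auto simp: orient_eq)

text \<open>Only finitely many directions occur among the edges, and on these \<open>\<phi>\<close>
  is a combination of rotated copies of \<open>horizontal_part\<close>. Each copy is additive by the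
  horizontal case, applied to the dissection multiplied by \<open>cnj d\<close>.\<close>

proposition (in triangle_dissection) boundary_sum_additive:
  assumes "real_homogeneous \<phi>"
  shows "boundary_sum \<phi> A B C = (\<Sum>i\<in>I. boundary_sum \<phi> (p i) (q i) (r i))"
proof -
  define E where "E = (\<Union>i\<in>I. {q i - p i, r i - q i, p i - r i}) \<union> {B - A, C - B, A - C}"
  define D where "D = line_rep ` E"
  have finD: "finite D" unfolding D_def E_def using finite_index by simp
  have E0: "z \<noteq> 0" if z: "z \<in> E" for z
  proof -
    consider i where "i \<in> I" "z \<in> {q i - p i, r i - q i, p i - r i}" | "z \<in> {B - A, C - B, A - C}"
      using z unfolding E_def by blast
    then show ?thesis
    proof cases
      case 1
      then show ?thesis
        using orient_nonzero_distinct [of "p i" "q i" "r i"] orient_pos [of i] by auto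
    next
      case 2
      then show ?thesis
        using orient_nonzero_distinct [of A B C] outer_orient_pos by auto
    qed
  qed
  have dec: "\<phi> z = (\<Sum>d\<in>D. \<phi> d * horizontal_part (cnj d * z))" if "z \<in> E" for z
    using that E0 finD by (intro real_homogeneous_decompose assms) (auto simp: D_def)
  have dec3: "boundary_sum \<phi> a b c = (\<Sum>d\<in>D. \<phi> d * boundary_sum horizontal_part (cnj d * a) (cnj d * b) (cnj d * c))"
    if "{b - a, c - b, a - c} \<subseteq> E" for a b c
    using that unfolding boundary_sum_def
    by (simp add: dec [of "b - a"] dec [of "c - b"] dec [of "a - c"] sum.distrib distrib_left right_diff_distrib)
  have nz: "cnj d \<noteq> 0" if "d \<in> D" for d
    using that E0 unfolding D_def line_rep_def by (auto simp: sgn_zero_iff split: if_splits)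
  have "boundary_sum \<phi> A B C =
      (\<Sum>d\<in>D. \<phi> d * boundary_sum horizontal_part (cnj d * A) (cnj d * B) (cnj d * C))"
    by (rule dec3) (auto simp: E_def)
  also have "\<dots> = (\<Sum>d\<in>D. \<phi> d * (\<Sum>i\<in>I. boundary_sum horizontal_part (cnj d * p i) (cnj d * q i) (cnj d * r i)))"
    using nz by (intro sum.cong refl arg_cong2 [where f = "(*)"]
      triangle_dissection.horizontal_part_additive dissection_mult)
  also have "\<dots> = (\<Sum>i\<in>I. \<Sum>d\<in>D. \<phi> d * boundary_sum horizontal_part (cnj d * p i) (cnj d * q i) (cnj d * r i))"
    unfolding sum_distrib_left by (rule sum.swap)
  also have "\<dots> = (\<Sum>i\<in>I. boundary_sum \<phi> (p i) (q i) (r i))"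
    by (intro sum.cong refl dec3 [symmetric]) (auto simp: E_def)
  finally show ?thesis .
qed

section \<open>Irrationality of the angle\<close>

abbreviation int_poly_eval :: "int poly \<Rightarrow> complex \<Rightarrow> complex" where
  "int_poly_eval p z \<equiv> poly (map_poly of_int p) z"

lemma int_poly_eval_pCons: "int_poly_eval (pCons a p) z = of_int a + z * int_poly_eval p z"
  by (simp add: map_poly_pCons)

lemma int_poly_eval_add: "int_poly_eval (p + q) z = int_poly_eval p z + int_poly_eval q z"
proof -
  have "map_poly of_int (p + q) = map_poly of_int p + (map_poly of_int q :: complex poly)"
    by (intro poly_eqI) (simp add: coeff_map_poly)
  then show ?thesis by simp
qed

lemma int_poly_eval_smult: "int_poly_eval (smult a p) z = of_int a * int_poly_eval p z"
  by (simp add: map_poly_smult)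

lemma int_poly_eval_diff: "int_poly_eval (p - q) z = int_poly_eval p z - int_poly_eval q z"
  using int_poly_eval_add [of "p - q" q z] by simp

lemma int_poly_eval_mult: "int_poly_eval (p * q) z = int_poly_eval p z * int_poly_eval q z"
  by (induction p) (simp_all add: int_poly_eval_pCons int_poly_eval_add int_poly_eval_smult algebra_simps)

text \<open>Rescaled Chebyshev polynomials: the n-th one sends 2 cos x to 2 cos (n x). Being monic
  for positive n, they make 2 cos x an algebraic integer whenever x is a rational multiple of
  \<pi>.\<close>

fun lucas_poly :: "nat \<Rightarrow> int poly" where
  "lucas_poly 0 = [:2:]"
| "lucas_poly (Suc 0) = [:0, 1:]"
| "lucas_poly (Suc (Suc n)) = [:0, 1:] * lucas_poly (Suc n) - lucas_poly n"

lemma degree_diff_eq_left: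
  fixes p q :: "'a::ab_group_add poly"
  assumes "degree q < degree p"
  shows "degree (p - q) = degree p"
  using degree_add_eq_left [of "- q" p] assms by simp

lemma degree_lucas_poly: "degree (lucas_poly n) = n"
  and lead_coeff_lucas_poly: "n > 0 \<Longrightarrow> coeff (lucas_poly n) n = 1"
proof (induction n rule: lucas_poly.induct)
  case (3 n)
  {
    case 1
    have nz: "lucas_poly (Suc n) \<noteq> 0" using 3(1) by auto
    have "degree ([:0, 1:] * lucas_poly (Suc n)) = Suc (Suc n)"
      using nz 3(1) by (simp add: degree_mult_eq)
    then show ?case using 3 by (simp add: degree_diff_eq_left)
  next
    case 2
    have "coeff (lucas_poly n) (Suc (Suc n)) = 0" using 3(3) by (intro coeff_eq_0) simp
    then show ?case using 3(2) by simp
  }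
qed auto

lemma int_poly_eval_lucas_poly:
  assumes "w \<noteq> 0"
  shows "int_poly_eval (lucas_poly n) (w + 1 / w) = w ^ n + 1 / w ^ n"
proof (induction n rule: lucas_poly.induct)
  case (3 n)
  have "int_poly_eval (lucas_poly (Suc (Suc n))) (w + 1 / w)
      = (w + 1 / w) * (w ^ Suc n + 1 / w ^ Suc n) - (w ^ n + 1 / w ^ n)"
    unfolding lucas_poly.simps int_poly_eval_diff int_poly_eval_mult 3 by (simp add: int_poly_eval_pCons)
  also have "\<dots> = w ^ Suc (Suc n) + 1 / w ^ Suc (Suc n)"
    using assms by (simp add: field_simps)
  finally show ?case .
qed (simp_all add: int_poly_eval_pCons)

text \<open>Write z = w + 1/w. Then w^n + 1/w^n = 2 means (w^n - 1)^2 = 0, so w is a root of unity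
  and 1/w is its conjugate.\<close>

lemma lucas_poly_eq_2_root:
  assumes "int_poly_eval (lucas_poly n) z = 2" "n > 0"
  shows "z \<in> \<real>"
proof -
  define w where "w = (z + csqrt (z\<^sup>2 - 4)) / 2"
  have w: "w * (z - w) = 1"
  proof -
    have "w * (z - w) = (z\<^sup>2 - (csqrt (z\<^sup>2 - 4))\<^sup>2) / 4"
      unfolding w_def by (simp add: power2_eq_square field_simps)
    then show ?thesis by simp
  qed
  then have w0: "w \<noteq> 0" by auto
  have z: "z = w + 1 / w" using w w0 by (simp add: field_simps)
  have "w ^ n + 1 / w ^ n = 2"
    using assms(1) unfolding z int_poly_eval_lucas_poly [OF w0] .
  then have "(w ^ n - 1)\<^sup>2 = 0"
    using w0 by (simp add: power2_eq_square field_simps)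
  then have "w ^ n = 1" by simp
  then have "norm w = 1"
    using assms(2) by (metis norm_one norm_power norm_ge_zero power_eq_1_iff zero_less_iff_neq_zero)
  then have "1 / w = cnj w"
    by (metis complex_norm_square mult.commute nonzero_eq_divide_eq of_real_1 one_power2 w0)
  then show ?thesis
    unfolding z by (simp add: complex_is_Real_iff)
qed

text \<open>Up to sign the constant coefficient is the leading one times the product of the roots,
  which are split off one at a time.\<close>

lemma norm_const_coeff_le:
  fixes p :: "complex poly"
  assumes "\<And>z. poly p z = 0 \<Longrightarrow> norm z \<le> 1"
  shows "norm (poly p 0) \<le> norm (lead_coeff p)"
  using assms
proof (induction "degree p" arbitrary: p)
  case 0
  then obtain c where "p = [:c:]" by (metis degree_eq_zeroE)
  then show ?case by simp
next
  case (Suc n)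
  then obtain z where z: "poly p z = 0"
    using fundamental_theorem_of_algebra [of p] by (auto simp: constant_degree)
  then obtain q where q: "p = [:- z, 1:] * q"
    by (metis dvdE poly_eq_0_iff_dvd)
  have "q \<noteq> 0" using q Suc(2) by auto
  then have "degree p = Suc (degree q)" unfolding q by (simp add: degree_mult_eq del: mult_pCons_left)
  then have "n = degree q" using Suc(2) by simp
  moreover have "norm y \<le> 1" if "poly q y = 0" for y
    using that Suc(3) [of y] by (simp add: q)
  ultimately have "norm (poly q 0) \<le> norm (lead_coeff q)" by (rule Suc(1))
  moreover have "norm z \<le> 1" using z by (rule Suc(3))
  ultimately have "norm z * norm (poly q 0) \<le> 1 * norm (lead_coeff q)"
    by (intro mult_mono) auto
  then show ?case
    unfolding q lead_coeff_mult by (simp add: norm_mult)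
qed

text \<open>The minimal polynomial of \<open>x\<close> in primitive form. Pseudo-division keeps
  everything over the integers, at the price of the factor \<open>c\<close>.\<close>

lemma minimal_int_poly:
  assumes "F \<noteq> 0" "int_poly_eval F x = 0"
  obtains m where "m \<noteq> 0" "int_poly_eval m x = 0" "content m = 1"
    "\<And>f. int_poly_eval f x = 0 \<Longrightarrow> \<exists>c q. c \<noteq> 0 \<and> smult c f = m * q"
    "\<And>f. f \<noteq> 0 \<Longrightarrow> int_poly_eval f x = 0 \<Longrightarrow> degree m \<le> degree f"
proof -
  define Z where "Z = (\<lambda>f :: int poly. f \<noteq> 0 \<and> int_poly_eval f x = 0)"
  obtain m0 where m0: "Z m0" "\<And>f. Z f \<Longrightarrow> degree m0 \<le> degree f"
    using ex_has_least_nat [of Z F degree] assms unfolding Z_def by auto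
  define m where "m = primitive_part m0"
  have c0: "content m0 \<noteq> 0" using m0(1) by (simp add: Z_def)
  have m: "m \<noteq> 0" "content m = 1" "degree m = degree m0"
    using m0(1) by (auto simp: m_def Z_def)
  have "int_poly_eval (smult (content m0) m) x = 0"
    using m0(1) by (simp add: m_def Z_def)
  then have ev: "int_poly_eval m x = 0"
    using c0 unfolding int_poly_eval_smult by simp
  show ?thesis
  proof (rule that [OF m(1) ev m(2)])
    show "degree m \<le> degree f" if "f \<noteq> 0" "int_poly_eval f x = 0" for f
      using m0(2) [of f] that m(3) by (simp add: Z_def)
    show "\<exists>c q. c \<noteq> 0 \<and> smult c f = m * q" if f: "int_poly_eval f x = 0" for f
    proof -
      obtain q r where qr: "pseudo_divmod f m = (q, r)" by fastforce
      define c where "c = coeff m (degree m) ^ (Suc (degree f) - degree m)"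
      have c: "smult c f = m * q + r" "r = 0 \<or> degree r < degree m"
        using pseudo_divmod [OF m(1) qr] by (simp_all add: c_def)
      have "int_poly_eval (smult c f) x = int_poly_eval (m * q + r) x" by (simp add: c(1))
      then have "int_poly_eval r x = 0"
        by (simp add: int_poly_eval_smult int_poly_eval_add int_poly_eval_mult f ev)
      then have "r = 0"
        using c(2) m0(2) [of r] m(3) unfolding Z_def by linarith
      moreover have "c \<noteq> 0" using m(1) by (simp add: c_def)
      ultimately show ?thesis using c(1) by auto
    qed
  qed
qed

text \<open>Gauss's lemma: contents multiply, so \<open>q\<close> has content
  \<open>\<bar>c\<bar>\<close>. Cancelling it, \<open>m\<close> divides \<open>f\<close> up to sign
  over the integers, and its leading coefficient divides 1.\<close>

lemma primitive_divides_monic: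
  fixes m f q :: "int poly"
  assumes "smult c f = m * q" "c \<noteq> 0" "content m = 1" "lead_coeff f = 1"
  shows "\<bar>lead_coeff m\<bar> = 1"
proof -
  have "content f dvd lead_coeff f" by (rule content_dvd_coeff)
  then have f: "content f = 1" using assms(4) by (metis is_unit_content_iff)
  have "content (smult c f) = content q"
    unfolding assms(1) content_mult assms(3) by simp
  then have "content q = \<bar>c\<bar>" using f by simp
  then have "q = smult \<bar>c\<bar> (primitive_part q)"
    by (metis content_times_primitive_part)
  then have "smult c f = smult \<bar>c\<bar> (m * primitive_part q)"
    unfolding assms(1) by (metis mult_smult_right)
  then have "lead_coeff (smult c f) = lead_coeff (smult \<bar>c\<bar> (m * primitive_part q))" by simp
  then have "c = \<bar>c\<bar> * (lead_coeff m * lead_coeff (primitive_part q))"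
    by (simp only: lead_coeff_smult lead_coeff_mult assms(4) mult_1_right)
  then have "\<bar>c\<bar> = \<bar>c\<bar> * \<bar>lead_coeff m * lead_coeff (primitive_part q)\<bar>"
    by (metis abs_abs abs_mult)
  then have "\<bar>lead_coeff m * lead_coeff (primitive_part q)\<bar> = 1"
    using assms(2) by simp
  then have "lead_coeff m dvd 1"
    by (metis dvd_triv_left zdvd1_eq abs_dvd_iff dvd_abs_iff)
  then show ?thesis by (simp only: zdvd1_eq)
qed

text \<open>The conjugates of \<open>2 cos \<phi>\<close> are real, and the quadratic relation confines them to
  \<open>[-1, 1]\<close>; so the norm of \<open>2 cos \<phi>\<close> would be a nonzero integer of absolute value less than 1.\<close>

proposition no_rational_cosine:
  fixes \<phi> s :: real and P :: "int poly"
  assumes s: "s = 2 * cos \<phi>" "0 < s" "s < 1"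
    and n: "0 < n" "cos (real n * \<phi>) = 1"
    and N: "N > 0" "(int_poly_eval P (of_real s))\<^sup>2 = of_nat N * (1 - (of_real s)\<^sup>2)"
  shows False
proof -
  \<comment> \<open>\<open>G\<close> has only real roots, and \<open>F\<close> encodes the quadratic
    relation. Both vanish at \<open>s\<close>, hence at every root of its minimal polynomial
    \<open>m\<close>.\<close>
  define G where "G = lucas_poly n - [:2:]"
  define F where "F = P * P - smult (int N) [:1, 0, -1:]"
  have lcG: "lead_coeff G = 1"
  proof -
    have "degree G = n" unfolding G_def
      using n(1) by (subst degree_diff_eq_left) (simp_all add: degree_lucas_poly)
    then show ?thesis
      using n(1) lead_coeff_lucas_poly [of n] by (cases n) (simp_all add: G_def)
  qed
  then have G0: "G \<noteq> 0" by auto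
  have evG: "int_poly_eval G z = int_poly_eval (lucas_poly n) z - 2" for z
    by (simp add: G_def int_poly_eval_diff int_poly_eval_pCons)
  have evF: "int_poly_eval F z = (int_poly_eval P z)\<^sup>2 - of_nat N * (1 - z\<^sup>2)" for z
    by (simp add: F_def int_poly_eval_diff int_poly_eval_mult int_poly_eval_smult int_poly_eval_pCons
      power2_eq_square algebra_simps)
  have "1 / cis \<phi> = cis (- \<phi>)" by (simp add: divide_inverse)
  then have scis: "of_real s = cis \<phi> + 1 / cis \<phi>"
    by (simp add: s(1) complex_eq_iff)
  have "int_poly_eval (lucas_poly n) (of_real s) = cis \<phi> ^ n + 1 / cis \<phi> ^ n"
    unfolding scis by (rule int_poly_eval_lucas_poly) simp
  also have "cis \<phi> ^ n = 1"
  proof -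
    have "(sin (real n * \<phi>))\<^sup>2 = 0" using n(2) sin_cos_squared_add [of "real n * \<phi>"] by simp
    then show ?thesis
      using n(2) cos_n_Re_cis_pow_n [of n \<phi>] sin_n_Im_cis_pow_n [of n \<phi>] by (simp add: complex_eq_iff)
  qed
  finally have Gs: "int_poly_eval G (of_real s) = 0" by (simp add: evG)
  obtain m where m: "m \<noteq> 0" "int_poly_eval m (of_real s) = 0" "content m = 1"
    "\<And>f. int_poly_eval f (of_real s) = 0 \<Longrightarrow> \<exists>c q. c \<noteq> 0 \<and> smult c f = m * q"
    "\<And>f. f \<noteq> 0 \<Longrightarrow> int_poly_eval f (of_real s) = 0 \<Longrightarrow> degree m \<le> degree f"
    using minimal_int_poly [OF G0 Gs] by metis
  have root: "int_poly_eval f z = 0" if fs: "int_poly_eval f (of_real s) = 0" and mz: "int_poly_eval m z = 0" for f z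
  proof -
    obtain c q where c: "c \<noteq> 0" "smult c f = m * q" using m(4) [OF fs] by auto
    have "of_int c * int_poly_eval f z = int_poly_eval (m * q) z"
      unfolding c(2) [symmetric] by (simp add: int_poly_eval_smult)
    then show ?thesis using c(1) mz by (simp add: int_poly_eval_mult)
  qed
  have le1: "norm z \<le> 1" if mz: "int_poly_eval m z = 0" for z
  proof -
    have "int_poly_eval G z = 0" by (rule root [OF Gs mz])
    then obtain x where z: "z = of_real x"
      using lucas_poly_eq_2_root [of n z] n(1) by (auto simp: evG elim: Reals_cases)
    have "int_poly_eval F z = 0" by (rule root [OF _ mz]) (simp add: evF N(2))
    then have sq: "(int_poly_eval P z)\<^sup>2 = of_real (of_nat N * (1 - x\<^sup>2))"
      by (simp add: evF z)
    \<comment> \<open>At a real point \<open>P\<close> takes a real value, so its square is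
      nonnegative; this is what forces \<open>1 - x\<^sup>2\<close> to be nonnegative.\<close>
    have "cnj (int_poly_eval P z) = int_poly_eval P z"
      unfolding z by (induction P) (simp_all add: int_poly_eval_pCons)
    then obtain y where "int_poly_eval P z = of_real y"
      by (metis Reals_cnj_iff Reals_cases)
    then have "of_real (y\<^sup>2) = (of_real (of_nat N * (1 - x\<^sup>2)) :: complex)" using sq by simp
    then have "y\<^sup>2 = of_nat N * (1 - x\<^sup>2)" unfolding of_real_eq_iff .
    then have "0 \<le> of_nat N * (1 - x\<^sup>2)" by (metis zero_le_power2)
    then have "x\<^sup>2 \<le> 1" using N(1) by (simp add: zero_le_mult_iff)
    then show ?thesis by (simp add: z abs_square_le_1)
  qed
  obtain c q where "c \<noteq> 0" "smult c G = m * q" using m(4) [OF Gs] by auto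
  then have lcm: "\<bar>lead_coeff m\<bar> = 1" using primitive_divides_monic m(3) lcG by blast
  define p :: "complex poly" where "p = map_poly of_int m"
  have "lead_coeff p = of_int (lead_coeff m)" by (simp add: p_def coeff_map_poly degree_map_poly)
  then have lcp: "norm (lead_coeff p) = 1" using lcm by simp
  \<comment> \<open>The root \<open>s\<close> is split off because it alone is known to be strictly
    smaller than 1, which makes the bound strict.\<close>
  obtain q where q: "p = [:- of_real s, 1:] * q"
    using m(2) by (metis p_def dvdE poly_eq_0_iff_dvd)
  have "norm (poly q 0) \<le> norm (lead_coeff q)"
    using le1 by (intro norm_const_coeff_le) (auto simp: p_def [symmetric] q)
  moreover have "norm (lead_coeff q) = 1"
    using lcp unfolding q lead_coeff_mult by simp
  ultimately have "norm (poly p 0) < 1"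
    using s by (simp add: q norm_mult) (smt (verit) mult_left_le)
  moreover have "poly p 0 = of_int (coeff m 0)"
    by (simp add: p_def poly_0_coeff_0 coeff_map_poly)
  \<comment> \<open>An integer of absolute value below 1 is 0. Then 0 is a root of \<open>m\<close>,
    and the cofactor still vanishes at the nonzero number \<open>s\<close>, against
    minimality.\<close>
  ultimately have "coeff m 0 = 0" by simp
  then obtain m' where m': "m = pCons 0 m'" by (metis coeff_pCons_0 pCons_cases)
  have "m' \<noteq> 0" using m(1) m' by auto
  moreover have "int_poly_eval m' (of_real s) = 0"
    using m(2) s(2) by (simp add: m' int_poly_eval_pCons)
  ultimately have "degree m \<le> degree m'" by (rule m(5))
  then show False using \<open>m' \<noteq> 0\<close> by (simp add: m')
qed

section \<open>Tiles sharing a segment\<close>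

definition rotations :: "'a \<Rightarrow> 'a \<Rightarrow> 'a \<Rightarrow> ('a \<times> 'a \<times> 'a) set" where
  "rotations p q r = {(p, q, r), (q, r, p), (r, p, q)}"

lemma rotations_tri:
  assumes "(x, y, z) \<in> rotations p q r"
  shows "tri x y z = tri p q r" "orient x y z = orient p q r"
  using assms tri_rotate orient_rotate unfolding rotations_def by auto

lemma orient_scale: "orient x y (m + of_real e * v) = orient x y m + e * (orient x y (x + v))"
  unfolding orient_eq by (simp add: algebra_simps)

lemma continuous_orient_third: "isCont (orient x y) m"
  using continuous_orient [of UNIV x y] by (simp add: continuous_on_eq_continuous_at)

lemma eventually_orient_pos:
  assumes "orient x y m > 0"
  shows "eventually (\<lambda>e. orient x y (m + of_real e * v) > 0) (at_right 0)"
proof -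
  have "((\<lambda>e. orient x y (m + of_real e * v)) \<longlongrightarrow> orient x y (m + of_real 0 * v)) (at_right 0)"
    by (intro isCont_tendsto_compose [OF continuous_orient_third] tendsto_intros)
  then have "((\<lambda>e. orient x y (m + of_real e * v)) \<longlongrightarrow> orient x y m) (at_right 0)" by simp
  then show ?thesis using assms by (rule order_tendstoD)
qed

text \<open>\<open>v\<close> points to the left of the edge, so the first orientation grows from 0;
  the other two are positive at the inner point \<open>m\<close> and stay so by continuity.\<close>

lemma eventually_interior_near_edge:
  assumes "orient x y z > 0" "m = x + of_real u * (y - x)" "0 < u" "u < 1" "orient x y (x + v) > 0"
  shows "eventually (\<lambda>e. m + of_real e * v \<in> interior (tri x y z)) (at_right 0)"
proof -
  have m: "orient x y m = 0" "orient y z m = (1 - u) * orient x y z" "orient z x m = u * orient x y z"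
    unfolding assms(2) orient_eq by (simp_all add: algebra_simps)
  have "eventually (\<lambda>e. orient y z (m + of_real e * v) > 0) (at_right 0)"
    "eventually (\<lambda>e. orient z x (m + of_real e * v) > 0) (at_right 0)"
    using assms m by (auto intro!: eventually_orient_pos)
  moreover have "eventually (\<lambda>e::real. e > 0) (at_right 0)" by (rule eventually_at_right_less)
  ultimately show ?thesis
  proof eventually_elim
    case (elim e)
    then show ?case
      using assms m by (intro interior_triI) (auto simp: orient_scale)
  qed
qed

lemma closed_segment_midpoint_inner:
  fixes a b x y :: complex
  assumes "a \<in> closed_segment x y" "b \<in> closed_segment x y" "a \<noteq> b"
  obtains u l where "midpoint a b = x + of_real u * (y - x)" "0 < u" "u < 1"
    "b - a = of_real l * (y - x)" "l \<noteq> (0::real)"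
proof -
  obtain s where s: "0 \<le> s" "s \<le> 1" "a = (1 - s) *\<^sub>R x + s *\<^sub>R y"
    using assms(1) by (auto simp: in_segment)
  obtain t where t: "0 \<le> t" "t \<le> 1" "b = (1 - t) *\<^sub>R x + t *\<^sub>R y"
    using assms(2) by (auto simp: in_segment)
  have st: "s \<noteq> t" using assms(3) s(3) t(3) by auto
  show ?thesis
  proof (rule that)
    show "midpoint a b = x + of_real ((s + t) / 2) * (y - x)"
      unfolding s(3) t(3) midpoint_def complex_eq_iff by (simp add: field_simps)
    show "0 < (s + t) / 2" "(s + t) / 2 < 1" using s t st by auto
    show "b - a = of_real (t - s) * (y - x)"
      unfolding s(3) t(3) complex_eq_iff by (simp add: algebra_simps)
    show "t - s \<noteq> 0" using st by simp
  qed
qed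

text \<open>Both triangles lie to the left of their edges. If the edges ran in the same direction,
  interior points of both would occur close to the midpoint of \<open>a\<close> and
  \<open>b\<close>.\<close>

lemma opposite_edges:
  assumes "orient x y z > 0" "orient x' y' z' > 0"
    and "interior (tri x y z) \<inter> interior (tri x' y' z') = {}"
    and ab: "a \<noteq> b" "{a, b} \<subseteq> closed_segment x y \<inter> closed_segment x' y'"
  shows "\<exists>k>0. y' - x' = - (of_real k * (y - x))"
proof -
  obtain u l where u: "midpoint a b = x + of_real u * (y - x)" "0 < u" "u < 1"
    "b - a = of_real l * (y - x)" "l \<noteq> (0::real)"
    using closed_segment_midpoint_inner [of a x y b] ab by auto
  obtain u' l' where u': "midpoint a b = x' + of_real u' * (y' - x')" "0 < u'" "u' < 1"
    "b - a = of_real l' * (y' - x')" "l' \<noteq> (0::real)"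
    using closed_segment_midpoint_inner [of a x' y' b] ab by auto
  define k where "k = l / l'"
  have k0: "k \<noteq> 0" using u(5) u'(5) by (simp add: k_def)
  have dir: "y' - x' = of_real k * (y - x)"
    unfolding k_def using u(4,5) u'(4,5) by (simp add: field_simps)
  show ?thesis
  proof (cases "k < 0")
    case True
    then show ?thesis using dir by (intro exI [of _ "- k"]) auto
  next
    case False
    then have pos: "k > 0" using k0 by simp
    define v where "v = \<i> * (y - x)"
    have xy: "x \<noteq> y" using assms(1) by (auto simp: orient_eq)
    have n: "(Re y - Re x)\<^sup>2 + (Im y - Im x)\<^sup>2 > 0"
      using xy by (metis cmod_power2 minus_complex.sel norm_eq_zero right_minus_eq zero_less_power2)
    have 1: "orient x y (x + v) > 0"
      using n by (simp add: orient_eq v_def power2_eq_square algebra_simps)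
    have "orient x' y' (x' + v) = k * orient x y (x + v)"
      unfolding orient_def dir by (simp add: v_def algebra_simps)
    then have 2: "orient x' y' (x' + v) > 0" using 1 pos by simp
    have "eventually (\<lambda>e. midpoint a b + of_real e * v \<in> interior (tri x y z)) (at_right 0)"
      by (rule eventually_interior_near_edge [OF assms(1) u(1-3) 1])
    moreover have "eventually (\<lambda>e. midpoint a b + of_real e * v \<in> interior (tri x' y' z')) (at_right 0)"
      by (rule eventually_interior_near_edge [OF assms(2) u'(1-3) 2])
    ultimately have "eventually (\<lambda>e::real. False) (at_right 0)"
      by eventually_elim (use assms(3) in auto)
    then show ?thesis by simp
  qed
qed

text \<open>The shared segment is infinite and covered by the pairwise intersections of edges, at
  most nine, so some two edges have two points in common.\<close>

lemma share_segment_opposite_edges: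
  assumes "orient p q r > 0" "orient p' q' r' > 0"
    and "interior (tri p q r) \<inter> interior (tri p' q' r') = {}"
    and "share_segment (tri p q r) (tri p' q' r')"
  obtains x y z x' y' z' k where "(x, y, z) \<in> rotations p q r" "(x', y', z') \<in> rotations p' q' r'"
    "0 < k" "y' - x' = - (of_real k * (y - x))"
proof -
  obtain a b where ab: "a \<noteq> b" "closed_segment a b \<subseteq> frontier (tri p q r) \<inter> frontier (tri p' q' r')"
    using assms(4) by (auto simp: share_segment_def)
  let ?E = "\<lambda>(x, y, z). closed_segment x y :: complex set"
  let ?J = "\<lambda>(e, e'). ?E e \<inter> ?E e'"
  have "closed_segment a b \<subseteq> (\<Union>e \<in> rotations p q r \<times> rotations p' q' r'. ?J e)"
    using ab(2) unfolding frontier_tri rotations_def by auto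
  moreover have "finite (rotations p q r \<times> rotations p' q' r')" by (simp add: rotations_def)
  moreover have "infinite (closed_segment a b)" using ab(1) by simp
  ultimately obtain e where e: "e \<in> rotations p q r \<times> rotations p' q' r'" "infinite (?J e)"
    by (meson finite_UN finite_subset)
  then obtain c where c: "c \<in> ?J e" by (metis finite.emptyI all_not_in_conv)
  have "infinite (?J e - {c})" using e(2) by simp
  then obtain d where d: "d \<in> ?J e - {c}" by (metis finite.emptyI all_not_in_conv)
  obtain x y z x' y' z' where exy: "e = ((x, y, z), (x', y', z'))" by (metis prod_cases3 surj_pair)
  have rot: "(x, y, z) \<in> rotations p q r" "(x', y', z') \<in> rotations p' q' r'"
    using e(1) exy by auto
  have "\<exists>k>0. y' - x' = - (of_real k * (y - x))"
  proof (rule opposite_edges)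
    show "orient x y z > 0" "orient x' y' z' > 0"
      "interior (tri x y z) \<inter> interior (tri x' y' z') = {}"
      using assms rotations_tri [OF rot(1)] rotations_tri [OF rot(2)] by simp_all
    show "c \<noteq> d" "{c, d} \<subseteq> closed_segment x y \<inter> closed_segment x' y'"
      using c d exy by auto
  qed
  then show ?thesis using that rot by blast
qed

context triangle_dissection
begin

abbreviation tile :: "'i \<Rightarrow> complex set" where
  "tile i \<equiv> tri (p i) (q i) (r i)"

lemma interior_disjoint:
  assumes "i \<in> I" "j \<in> I" "i \<noteq> j"
  shows "interior (tile i) \<inter> interior (tile j) = {}"
  using overlap [OF assms] interior_subset [of "tile i"] interior_subset [of "tile j"]
  by (auto simp: frontier_def)

text \<open>By convexity two common points bring along the whole segment between them, and it lies
  in both frontiers.\<close>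

lemma finite_inter_unless_share_segment:
  assumes "i \<in> I" "j \<in> I" "i \<noteq> j" "\<not> share_segment (tile i) (tile j)"
  shows "finite (tile i \<inter> tile j)"
proof (rule ccontr)
  assume inf: "infinite (tile i \<inter> tile j)"
  then obtain a where a: "a \<in> tile i \<inter> tile j" by (metis finite.emptyI all_not_in_conv)
  have "infinite (tile i \<inter> tile j - {a})" using inf by simp
  then obtain b where b: "b \<in> tile i \<inter> tile j - {a}" by (metis finite.emptyI all_not_in_conv)
  have "closed_segment a b \<subseteq> tile i \<inter> tile j"
    using a b by (intro closed_segment_subset convex_Int) auto
  also have "\<dots> \<subseteq> frontier (tile i) \<inter> frontier (tile j)"
    using overlap [of i j] overlap [of j i] assms by blast
  finally show False
    using assms(4) b unfolding share_segment_def by auto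
qed

lemma infinite_tile:
  assumes "i \<in> I"
  shows "infinite (tile i)"
proof -
  have "closed_segment (p i) (q i) \<subseteq> tile i" by (simp add: closed_segment_subset)
  moreover have "p i \<noteq> q i" using orient_pos [OF assms] by (auto simp: orient_eq)
  ultimately show ?thesis by (metis finite_closed_segment finite_subset)
qed

text \<open>Otherwise a finite set would separate the dissected triangle.\<close>

lemma exists_neighbour:
  assumes "S \<subseteq> I" "S \<noteq> {}" "S \<noteq> I"
  obtains i j where "i \<in> S" "j \<in> I - S" "share_segment (tile i) (tile j)"
proof (rule ccontr)
  note neighbour = that
  assume "\<not> thesis"
  then have no: "\<not> share_segment (tile i) (tile j)" if "i \<in> S" "j \<in> I - S" for i j
    using neighbour \<open>\<not> thesis\<close> that by blast
  define F where "F = (\<Union>i\<in>S. \<Union>j\<in>I - S. tile i \<inter> tile j)"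
  have finS: "finite S" "finite (I - S)" using assms finite_index finite_subset by auto
  have "finite F"
    unfolding F_def using finS no assms(1)
    by (intro finite_UN_I finite_inter_unless_share_segment) auto
  define U where "U = (\<Union>i\<in>S. tile i)"
  define V where "V = (\<Union>j\<in>I - S. tile j)"
  have "\<not> collinear (tri A B C)"
  proof
    assume "collinear (tri A B C)"
    then have "collinear {A, B, C}" by (rule collinear_subset) auto
    then show False using collinear_orient_zero outer_orient_pos by force
  qed
  then have "connected (tri A B C - F)"
    using \<open>finite F\<close> by (intro connected_convex_diff_countable) (auto intro: countable_finite)
  moreover have "closed U" "closed V"
    unfolding U_def V_def using finS by (auto intro: closed_UN)
  moreover have "tri A B C - F \<subseteq> U \<union> V"
    unfolding cover [symmetric] U_def V_def by auto
  moreover have "U \<inter> V \<inter> (tri A B C - F) = {}"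
    unfolding U_def V_def F_def by auto
  moreover have nonempty: "tile i \<inter> (tri A B C - F) \<noteq> {}" if "i \<in> I" for i
  proof
    assume "tile i \<inter> (tri A B C - F) = {}"
    then have "tile i \<subseteq> F" using cover that by auto
    then show False using \<open>finite F\<close> infinite_tile [OF that] finite_subset by blast
  qed
  obtain i j where "i \<in> S" "j \<in> I - S" using assms by blast
  then have "U \<inter> (tri A B C - F) \<noteq> {}" "V \<inter> (tri A B C - F) \<noteq> {}"
    using nonempty [of i] nonempty [of j] assms(1) unfolding U_def V_def by auto
  ultimately show False unfolding connected_closed by blast
qed

end

section \<open>The angles at the apex\<close>

lemma orient_polar:
  assumes "norm d = 1"
  shows "orient A (A + of_real l * (cis \<phi> * d)) (A + of_real m * (cis \<psi> * d)) = l * m * sin (\<psi> - \<phi>)"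
proof -
  have d: "Re d * Re d + Im d * Im d = 1"
    using assms cmod_power2 [of d] by (simp add: power2_eq_square)
  have "orient A (A + of_real l * (cis \<phi> * d)) (A + of_real m * (cis \<psi> * d))
      = l * m * sin (\<psi> - \<phi>) * (Re d * Re d + Im d * Im d)"
    unfolding orient_eq sin_diff by (simp add: algebra_simps)
  then show ?thesis by (simp add: d)
qed

lemma mult_nonneg_cancel:
  fixes c x :: real
  assumes "0 < c"
  shows "0 \<le> c * x \<longleftrightarrow> 0 \<le> x"
  using assms by (simp add: zero_le_mult_iff)

lemma sin_nonneg_imp_nonneg:
  fixes x :: real
  assumes "0 \<le> sin x" "- pi < x"
  shows "0 \<le> x"
  using assms sin_gt_zero [of "- x"] by fastforce

lemma sin_pos_imp_pos:
  fixes x :: real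
  assumes "0 < sin x" "- pi < x"
  shows "0 < x"
  using sin_nonneg_imp_nonneg [of x] assms by (cases "x = 0") auto

text \<open>The two sign conditions say that the sines of \<phi> and \<theta> - \<phi> are
  nonnegative. Both angles exceed -\<pi>, so they are nonnegative themselves.\<close>

lemma polar_in_cone:
  assumes "norm d = 1" "0 < X" "0 < X'" "0 < \<theta>" "\<theta> < pi"
    and "B = A + of_real X * d" "C = A + of_real X' * (cis \<theta> * d)"
    and "z \<noteq> A" "0 \<le> orient A B z" "0 \<le> orient A z C"
  obtains l \<phi> where "0 < l" "0 \<le> \<phi>" "\<phi> \<le> \<theta>" "z = A + of_real l * (cis \<phi> * d)"
proof -
  define w where "w = (z - A) / d"
  have d0: "d \<noteq> 0" using assms(1) by auto
  have w0: "w \<noteq> 0" using assms(8) d0 by (simp add: w_def)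
  define l where "l = norm w"
  define \<phi> where "\<phi> = Arg w"
  have l: "0 < l" using w0 by (simp add: l_def)
  have "w = of_real l * cis \<phi>"
    using w0 by (simp add: l_def \<phi>_def cis_Arg sgn_div_norm scaleR_conv_of_real)
  then have z: "z = A + of_real l * (cis \<phi> * d)"
    using d0 by (simp add: w_def field_simps)
  have bounds: "- pi < \<phi>" "\<phi> \<le> pi" using Arg_bounded [of w] by (simp_all add: \<phi>_def)
  have B: "B = A + of_real X * (cis 0 * d)" using assms(6) by simp
  have "0 \<le> X * l * sin (\<phi> - 0)"
    using assms(9) unfolding B z orient_polar [OF assms(1)] .
  then have "0 \<le> sin \<phi>"
    by (simp only: mult_nonneg_cancel [OF mult_pos_pos [OF assms(2) l]] diff_zero)
  then have \<phi>0: "0 \<le> \<phi>" using bounds(1) by (rule sin_nonneg_imp_nonneg)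
  have "0 \<le> l * X' * sin (\<theta> - \<phi>)"
    using assms(10) unfolding assms(7) z orient_polar [OF assms(1)] .
  then have "0 \<le> sin (\<theta> - \<phi>)"
    by (simp only: mult_nonneg_cancel [OF mult_pos_pos [OF l assms(3)]])
  then have "0 \<le> \<theta> - \<phi>"
    by (rule sin_nonneg_imp_nonneg) (use bounds assms(4) in linarith)
  then show ?thesis using that l \<phi>0 z by simp
qed

text \<open>An extreme point of the big triangle stays extreme in any subset containing it, and
  extreme points of a triangle are vertices.\<close>

lemma (in triangle_dissection) apex_is_vertex:
  assumes "i \<in> I" "A \<in> tile i"
  shows "A \<in> {p i, q i, r i}"
proof -
  have "\<not> collinear {A, B, C}"
    using collinear_orient_zero outer_orient_pos by force
  then have "\<not> affine_dependent {A, B, C}"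
    by (simp add: collinear_3_eq_affine_dependent)
  then have "A extreme_point_of tri A B C"
    unfolding tri_def by (simp add: extreme_point_of_convex_hull_affine_independent)
  moreover have "tile i \<subseteq> tri A B C" using cover assms(1) by auto
  ultimately have "A extreme_point_of tile i"
    using assms(2) unfolding extreme_point_of_def by blast
  then show ?thesis
    unfolding tri_def by (rule extreme_point_of_convex_hull)
qed

text \<open>Follow the ray from \<open>A\<close> at angle \<phi>. Close to \<open>A\<close> it meets
  only tiles containing \<open>A\<close> whose interval from \<open>lo\<close> to \<open>hi\<close>
  contains \<phi>, and it runs in their interior if \<phi> is strictly inside. Hence these intervals
  cover that from 0 to \<theta> and overlap in null sets, so their lengths add.\<close>

lemma (in triangle_dissection) apex_angles:
  assumes d: "norm d = 1" and X: "0 < X" "0 < X'" and \<theta>: "0 < \<theta>" "\<theta> < pi"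
    and B: "B = A + of_real X * d" and C: "C = A + of_real X' * (cis \<theta> * d)"
  obtains lo hi l m where
    "\<forall>i\<in>I. A \<in> tile i \<longrightarrow> 0 \<le> lo i \<and> lo i < hi i \<and> hi i \<le> \<theta> \<and> 0 < l i \<and> 0 < m i \<and>
      (A, A + of_real (l i) * (cis (lo i) * d), A + of_real (m i) * (cis (hi i) * d)) \<in> rotations (p i) (q i) (r i)"
    "(\<Sum>i | i \<in> I \<and> A \<in> tile i. hi i - lo i) = \<theta>"
proof -
  define K where "K = {i. i \<in> I \<and> A \<in> tile i}"
  define ray where "ray = (\<lambda>\<rho> \<phi>. A + of_real \<rho> * (cis \<phi> * d))"
  have orient_ray: "orient A (ray l \<phi>) (ray m \<psi>) = l * m * sin (\<psi> - \<phi>)" for l m \<phi> \<psi>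
    unfolding ray_def by (rule orient_polar [OF d])
  have orient_ray': "orient (ray m \<psi>) A (ray l \<phi>) = l * m * sin (\<psi> - \<phi>)" for l m \<phi> \<psi>
    using orient_ray [of l \<phi> m \<psi>] by (simp add: orient_eq algebra_simps)
  have Br: "B = ray X 0" and Cr: "C = ray X' \<theta>" by (simp_all add: B C ray_def)
  define angles where "angles = (\<lambda>i lo hi l m. 0 \<le> lo \<and> lo < hi \<and> hi \<le> \<theta> \<and> 0 < l \<and> 0 < m \<and>
    (A, ray l lo, ray m hi) \<in> rotations (p i) (q i) (r i))"
  have "\<exists>lo hi l m. angles i lo hi l m" if "i \<in> K" for i
  proof -
    have i: "i \<in> I" "A \<in> {p i, q i, r i}" using that apex_is_vertex by (auto simp: K_def)
    obtain y z where yz: "(A, y, z) \<in> rotations (p i) (q i) (r i)"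
      using i(2) by (auto simp: rotations_def)
    have pos: "orient A y z > 0"
      using rotations_tri [OF yz] orient_pos [OF i(1)] by simp
    then have ne: "y \<noteq> A" "z \<noteq> A" by (auto simp: orient_eq)
    have "{y, z} \<subseteq> tile i" using rotations_tri(1) [OF yz] tri_vertices [of y A z] tri_vertices [of z A y]
      by (metis empty_subsetI insert_subset tri_vertices(2,3))
    then have "{y, z} \<subseteq> tri A B C" using cover i(1) by auto
    then have cone: "0 \<le> orient A B y" "0 \<le> orient A y C" "0 \<le> orient A B z" "0 \<le> orient A z C"
      unfolding tri_barycentric [OF outer_orient_pos] insert_subset
      by (simp_all add: orient_eq algebra_simps tri_barycentric [OF outer_orient_pos])
    obtain l lo where lo: "0 < l" "0 \<le> lo" "lo \<le> \<theta>" "y = ray l lo"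
      using polar_in_cone [OF d X \<theta> B C ne(1) cone(1,2)] unfolding ray_def by metis
    obtain m hi where hi: "0 < m" "0 \<le> hi" "hi \<le> \<theta>" "z = ray m hi"
      using polar_in_cone [OF d X \<theta> B C ne(2) cone(3,4)] unfolding ray_def by metis
    have "0 < sin (hi - lo)"
      using pos unfolding lo(4) hi(4) orient_ray by (rule zero_less_mult_pos [OF _ mult_pos_pos [OF lo(1) hi(1)]])
    then have "0 < hi - lo"
      by (rule sin_pos_imp_pos) (use lo hi \<theta> in linarith)
    then show ?thesis using lo hi yz unfolding angles_def by auto
  qed
  then obtain lo hi l m where ang: "\<And>i. i \<in> K \<Longrightarrow> angles i (lo i) (hi i) (l i) (m i)"
    by metis
  have rot: "(A, ray (l i) (lo i), ray (m i) (hi i)) \<in> rotations (p i) (q i) (r i)" if "i \<in> K" for i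
    using ang [OF that] by (simp add: angles_def)
  have tile: "tile i = tri A (ray (l i) (lo i)) (ray (m i) (hi i))" if "i \<in> K" for i
    using rotations_tri(1) [OF rot [OF that]] by simp
  have tile_pos: "orient A (ray (l i) (lo i)) (ray (m i) (hi i)) > 0" if "i \<in> K" for i
    using rotations_tri(2) [OF rot [OF that]] orient_pos [of i] that by (simp add: K_def)
  have contained: "lo i \<le> \<phi> \<and> \<phi> \<le> hi i"
    if i: "i \<in> K" and \<rho>: "0 < \<rho>" and \<phi>: "0 \<le> \<phi>" "\<phi> \<le> \<theta>" and mem: "ray \<rho> \<phi> \<in> tile i" for i \<rho> \<phi>
  proof -
    have a: "0 \<le> lo i" "lo i < hi i" "hi i \<le> \<theta>" "0 < l i" "0 < m i"
      using ang [OF i] by (simp_all add: angles_def)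
    have "0 \<le> orient A (ray (l i) (lo i)) (ray \<rho> \<phi>)" "0 \<le> orient (ray (m i) (hi i)) A (ray \<rho> \<phi>)"
      using mem unfolding tile [OF i] tri_barycentric [OF tile_pos [OF i]] by auto
    moreover have "0 < l i * \<rho>" "0 < \<rho> * m i" using a \<rho> by simp_all
    ultimately have "0 \<le> sin (\<phi> - lo i)" "0 \<le> sin (hi i - \<phi>)"
      by (simp_all only: orient_ray orient_ray' mult_nonneg_cancel)
    moreover have "- pi < \<phi> - lo i" "- pi < hi i - \<phi>" using a \<phi> \<theta> by linarith+
    ultimately have "0 \<le> \<phi> - lo i" "0 \<le> hi i - \<phi>"
      using sin_nonneg_imp_nonneg by blast+
    then show ?thesis by simp
  qed
  have inner: "eventually (\<lambda>\<rho>. ray \<rho> \<phi> \<in> interior (tile i)) (at_right 0)"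
    if i: "i \<in> K" and \<phi>: "lo i < \<phi>" "\<phi> < hi i" for i \<phi>
  proof -
    have a: "0 \<le> lo i" "lo i < hi i" "hi i \<le> \<theta>" "0 < l i" "0 < m i"
      using ang [OF i] by (simp_all add: angles_def)
    let ?y = "ray (l i) (lo i)" and ?z = "ray (m i) (hi i)"
    have "orient ?y ?z A > 0" using tile_pos [OF i] orient_rotate [of ?y ?z A] by simp
    then have "eventually (\<lambda>\<rho>. orient ?y ?z (ray \<rho> \<phi>) > 0) (at_right 0)"
      unfolding ray_def by (rule eventually_orient_pos)
    moreover have "eventually (\<lambda>\<rho>::real. \<rho> > 0) (at_right 0)" by (rule eventually_at_right_less)
    ultimately show ?thesis
    proof eventually_elim
      case (elim \<rho>)
      have "0 < sin (\<phi> - lo i)" "0 < sin (hi i - \<phi>)"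
        using a \<phi> \<theta> by (auto intro!: sin_gt_zero)
      then show ?case
        unfolding tile [OF i] using elim a tile_pos [OF i]
        by (intro interior_triI) (auto simp: orient_ray orient_ray')
    qed
  qed
  \<comment> \<open>Otherwise points of the ray near \<open>A\<close> would lie in the big triangle
    but in no tile: \<open>contained\<close> excludes the tiles at \<open>A\<close>, and the others
    stay away from a neighbourhood of \<open>A\<close>.\<close>
  have covered: "\<exists>i\<in>K. \<phi> \<in> {lo i..hi i}" if \<phi>: "\<phi> \<in> {0..\<theta>}" for \<phi>
  proof (rule ccontr)
    assume no: "\<not> (\<exists>i\<in>K. \<phi> \<in> {lo i..hi i})"
    have avoid: "eventually (\<lambda>\<rho>. ray \<rho> \<phi> \<notin> tile i) (at_right 0)" if i: "i \<in> I" for i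
    proof (cases "i \<in> K")
      case True
      have "eventually (\<lambda>\<rho>::real. \<rho> > 0) (at_right 0)" by (rule eventually_at_right_less)
      then show ?thesis
        by eventually_elim (use contained [OF True] no True \<phi> in auto)
    next
      case False
      then have "A \<in> - tile i" using i by (simp add: K_def)
      moreover have "open (- tile i)" by (simp add: open_Compl)
      moreover have "((\<lambda>\<rho>. ray \<rho> \<phi>) \<longlongrightarrow> A + of_real 0 * (cis \<phi> * d)) (at_right 0)"
        unfolding ray_def by (intro tendsto_intros)
      ultimately have "eventually (\<lambda>\<rho>. ray \<rho> \<phi> \<in> - tile i) (at_right 0)"
        by (intro topological_tendstoD) auto
      then show ?thesis by simp
    qed
    have "orient B C A > 0" using outer_orient_pos orient_rotate [of B C A] by simp
    then have "eventually (\<lambda>\<rho>. orient B C (ray \<rho> \<phi>) > 0) (at_right 0)"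
      unfolding ray_def by (rule eventually_orient_pos)
    moreover have "eventually (\<lambda>\<rho>. \<forall>i\<in>I. ray \<rho> \<phi> \<notin> tile i) (at_right 0)"
      using avoid finite_index by (simp add: eventually_ball_finite_distrib)
    moreover have "eventually (\<lambda>\<rho>::real. \<rho> > 0) (at_right 0)" by (rule eventually_at_right_less)
    ultimately have "eventually (\<lambda>\<rho>::real. False) (at_right 0)"
    proof eventually_elim
      case (elim \<rho>)
      have "0 \<le> sin (\<phi> - 0)" "0 \<le> sin (\<theta> - \<phi>)" using \<phi> \<theta> by (auto intro!: sin_ge_zero)
      then have "0 \<le> orient A B (ray \<rho> \<phi>)" "0 \<le> orient C A (ray \<rho> \<phi>)"
        unfolding Br Cr orient_ray orient_ray' using elim X by auto
      then have "ray \<rho> \<phi> \<in> tri A B C"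
        using elim by (simp add: tri_barycentric [OF outer_orient_pos])
      then show ?case using elim cover by auto
    qed
    then show False by simp
  qed
  have finK: "finite K" using finite_index by (simp add: K_def)
  have "(\<Union>i\<in>K. {lo i..hi i}) = {0..\<theta>}"
    using covered ang unfolding angles_def by fastforce
  then have "measure lebesgue {0..\<theta>} = measure lebesgue (\<Union>((\<lambda>i. {lo i..hi i}) ` K))"
    by simp
  also have "\<dots> = (\<Sum>i\<in>K. measure lebesgue {lo i..hi i})"
  proof (rule measure_negligible_finite_Union_image [OF finK])
    show "pairwise (\<lambda>i j. negligible ({lo i..hi i} \<inter> {lo j..hi j})) K"
    proof (rule pairwiseI)
      fix i j assume ij: "i \<in> K" "j \<in> K" "i \<noteq> j"
      have no: "\<not> (lo i < \<phi> \<and> \<phi> < hi i \<and> lo j < \<phi> \<and> \<phi> < hi j)" for \<phi>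
      proof
        assume "lo i < \<phi> \<and> \<phi> < hi i \<and> lo j < \<phi> \<and> \<phi> < hi j"
        then have "eventually (\<lambda>\<rho>. ray \<rho> \<phi> \<in> interior (tile i)) (at_right 0)"
          "eventually (\<lambda>\<rho>. ray \<rho> \<phi> \<in> interior (tile j)) (at_right 0)"
          using inner ij by auto
        then have "eventually (\<lambda>\<rho>::real. False) (at_right 0)"
          by eventually_elim (use interior_disjoint [of i j] ij in \<open>auto simp: K_def\<close>)
        then show False by simp
      qed
      have "{lo i..hi i} \<inter> {lo j..hi j} \<subseteq> {lo i, hi i, lo j, hi j}"
      proof
        fix x assume "x \<in> {lo i..hi i} \<inter> {lo j..hi j}"
        then show "x \<in> {lo i, hi i, lo j, hi j}" using no [of x] by auto
      qed
      then show "negligible ({lo i..hi i} \<inter> {lo j..hi j})"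
        by (meson finite.emptyI finite_insert finite_subset negligible_finite)
    qed
  qed auto
  also have "\<dots> = (\<Sum>i\<in>K. hi i - lo i)"
    using ang unfolding angles_def by (intro sum.cong) (auto simp: less_imp_le)
  finally have "(\<Sum>i\<in>K. hi i - lo i) = \<theta>" using \<theta> by simp
  then show ?thesis
    using that [of lo hi l m] ang unfolding angles_def K_def ray_def by blast
qed

section \<open>The shape of the tiles\<close>

text \<open>The law of cosines fixes the real part of \<open>w\<close>, the distances its norm, and
  the positive orientation the sign of its imaginary part.\<close>

lemma polar_of_law_of_cosines:
  assumes "orient p q r > 0" "0 < \<theta>" "\<theta> < pi"
    and "(dist q r)\<^sup>2 = (dist p q)\<^sup>2 + (dist p r)\<^sup>2 - 2 * dist p q * dist p r * cos \<theta>"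
  shows "r - p = of_real (dist p r / dist p q) * (cis \<theta> * (q - p))"
proof -
  define w where "w = cnj (q - p) * (r - p)"
  have pq: "dist p q > 0" and pr: "dist p r > 0"
    using assms(1) by (auto simp: orient_eq)
  have nw: "norm w = dist p q * dist p r"
    unfolding w_def norm_mult complex_mod_cnj dist_norm by (simp add: norm_minus_commute)
  have "Re w = ((dist p q)\<^sup>2 + (dist p r)\<^sup>2 - (dist q r)\<^sup>2) / 2"
    unfolding w_def dist_norm cmod_power2 by (simp add: power2_eq_square algebra_simps)
  then have re: "Re w = dist p q * dist p r * cos \<theta>"
    using assms(4) by simp
  have "(Im w)\<^sup>2 = (norm w)\<^sup>2 - (Re w)\<^sup>2"
    by (simp add: cmod_power2)
  also have "\<dots> = (dist p q * dist p r * sin \<theta>)\<^sup>2"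
    unfolding nw re power_mult_distrib sin_squared_eq by (simp add: algebra_simps)
  finally have "Im w = dist p q * dist p r * sin \<theta>"
  proof (rule power2_eq_imp_eq)
    show "0 \<le> Im w" using assms(1) by (simp add: w_def orient_def)
    show "0 \<le> dist p q * dist p r * sin \<theta>" using assms(2,3) by (simp add: sin_ge_zero)
  qed
  then have w: "w = of_real (dist p q * dist p r) * cis \<theta>"
    using re by (simp add: complex_eq_iff)
  have "of_real ((dist p q)\<^sup>2) = (q - p) * cnj (q - p)"
    unfolding dist_norm norm_minus_commute [of p q] by (rule complex_norm_square)
  then have "of_real ((dist p q)\<^sup>2) * (r - p) = (q - p) * w"
    unfolding w_def by (simp only: mult.assoc)
  then have "of_real (dist p q) * (of_real (dist p q) * (r - p)) =
      of_real (dist p q) * (of_real (dist p r) * (cis \<theta> * (q - p)))"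
    unfolding w by (simp add: power2_eq_square mult_ac)
  then have "of_real (dist p q) * (r - p) = of_real (dist p r) * (cis \<theta> * (q - p))"
    by (rule mult_left_cancel [THEN iffD1, rotated]) (use pq in simp)
  moreover have "of_real (dist p q) \<noteq> (0 :: complex)" using pq by simp
  ultimately have "r - p = of_real (dist p r) * (cis \<theta> * (q - p)) / of_real (dist p q)"
    by (metis nonzero_mult_div_cancel_left)
  then show ?thesis by simp
qed

text \<open>Counterclockwise triangles whose sides are those of the tile with angle \<open>\<theta>\<close> at \<open>p\<close>,
  in either of the two orientations; \<open>c\<close> is the longest side and \<open>a / c = 2 sin (\<theta> / 2)\<close>.\<close>

definition tile_shape :: "real \<Rightarrow> real \<Rightarrow> complex \<Rightarrow> complex \<Rightarrow> complex \<Rightarrow> bool" where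
  "tile_shape \<theta> c p q r \<longleftrightarrow> orient p q r > 0 \<and> dist q r = c * (2 * sin (\<theta> / 2)) \<and>
     (dist p q = c \<and> dist p r = c * (1 - (2 * sin (\<theta> / 2))\<^sup>2) \<or>
      dist p q = c * (1 - (2 * sin (\<theta> / 2))\<^sup>2) \<and> dist p r = c)"

lemma cos_eq_half_sin: "cos \<theta> = 1 - (2 * sin (\<theta> / 2))\<^sup>2 / (2::real)"
  using cos_double_sin [of "\<theta> / 2"] by (simp add: power_mult_distrib)

lemma tile_shape_polar:
  assumes "tile_shape \<theta> c p q r" "0 < \<theta>" "\<theta> < pi"
  shows "r - p = of_real (dist p r / dist p q) * (cis \<theta> * (q - p))"
proof (rule polar_of_law_of_cosines)
  consider "dist p q = c" "dist p r = c * (1 - (2 * sin (\<theta> / 2))\<^sup>2)"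
    | "dist p q = c * (1 - (2 * sin (\<theta> / 2))\<^sup>2)" "dist p r = c"
    using assms(1) by (auto simp: tile_shape_def)
  moreover have "dist q r = c * (2 * sin (\<theta> / 2))"
    using assms(1) by (simp add: tile_shape_def)
  ultimately show "(dist q r)\<^sup>2 = (dist p q)\<^sup>2 + (dist p r)\<^sup>2 - 2 * dist p q * dist p r * cos \<theta>"
    unfolding cos_eq_half_sin by cases (simp_all only:, simp_all add: power2_eq_square field_simps)
qed (use assms in \<open>auto simp: tile_shape_def\<close>)

text \<open>The tile angle \<gamma>: if \<beta> = (\<pi> - 3\<theta>)/2, then \<pi> - \<theta> -
  \<beta> has this value.\<close>

definition turn :: "real \<Rightarrow> real" where
  "turn \<theta> = (pi + \<theta>) / 2"

lemma cis_turn: "cis (turn \<theta>) = \<i> * cis (\<theta> / 2)"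
  by (simp add: turn_def add_divide_distrib cis_mult [symmetric] cis_pi_half)

lemma cis_2_turn: "cis (2 * turn \<theta>) = - cis \<theta>"
proof -
  have "2 * turn \<theta> = \<theta> + pi" by (simp add: turn_def)
  then show ?thesis by (simp add: minus_cis)
qed

text \<open>The side opposite the angle \<theta>, for the tile and for its mirror image, when
  \<open>c\<close> is 1. With u = cis (\<theta>/2) and s = -i (u - 1/u) both become identities of
  Laurent polynomials in u.\<close>

lemma cis_turn_identities:
  fixes \<theta> :: real
  defines "s \<equiv> 2 * sin (\<theta> / 2)"
  shows "of_real (1 - s\<^sup>2) * cis \<theta> - 1 = - of_real s * cis (3 * turn \<theta>)"
    and "cis \<theta> - of_real (1 - s\<^sup>2) = - of_real s * cis (- turn \<theta>)"
proof -
  define u where "u = cis (\<theta> / 2)"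
  have u0: "u \<noteq> 0" by (simp add: u_def)
  have iu: "cis (- (\<theta> / 2)) = inverse u" by (simp add: u_def)
  have s: "of_real s = - \<i> * (u - inverse u)"
    unfolding iu [symmetric] u_def s_def by (simp add: complex_eq_iff)
  have t: "cis (turn \<theta>) = \<i> * u" by (simp add: cis_turn u_def)
  have t3: "cis (3 * turn \<theta>) = (\<i> * u) ^ 3"
    unfolding t [symmetric] by (simp only: Complex.DeMoivre) simp
  have tm: "cis (- turn \<theta>) = inverse (\<i> * u)"
    unfolding t [symmetric] by simp
  have u2: "cis \<theta> = u\<^sup>2" unfolding u_def by (simp only: Complex.DeMoivre) simp
  have s2: "of_real (1 - s\<^sup>2) = 1 + (u - inverse u)\<^sup>2"
  proof -
    have "(of_real s)\<^sup>2 = - (u - inverse u)\<^sup>2"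
      unfolding s by (simp add: power_mult_distrib)
    then show ?thesis by simp
  qed
  show "of_real (1 - s\<^sup>2) * cis \<theta> - 1 = - of_real s * cis (3 * turn \<theta>)"
    unfolding s2 s t3 u2 using u0 by (simp add: field_simps power2_eq_square power3_eq_cube)
  show "cis \<theta> - of_real (1 - s\<^sup>2) = - of_real s * cis (- turn \<theta>)"
    unfolding s2 s tm u2 using u0 by (simp add: field_simps power2_eq_square)
qed

text \<open>The exponent \<open>j\<close> is 3 if the side \<open>c\<close> comes first and -1 for
  the mirror image. It is odd and occurs with a minus sign, while the other two edges have exponents
  0 and 2 and a plus sign.\<close>

lemma tile_shape_edges:
  assumes shape: "tile_shape \<theta> c p q r" and \<theta>: "0 < \<theta>" "\<theta> < pi"
  obtains d x z j where "norm d = 1" "j = 3 \<or> j = (-1::int)"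
    "q - p = of_real x * d"
    "r - q = - (of_real (c * (2 * sin (\<theta> / 2))) * (cis (of_int j * turn \<theta>) * d))"
    "p - r = of_real z * (cis (2 * turn \<theta>) * d)"
    "0 < x" "0 < z" "x = dist p q" "z = dist p r"
proof -
  define s where "s = 2 * sin (\<theta> / 2)"
  define x where "x = dist p q"
  define z where "z = dist p r"
  define d where "d = (q - p) / of_real x"
  have pos: "0 < x" "0 < z" using shape by (auto simp: tile_shape_def orient_eq x_def z_def)
  have nd: "norm d = 1"
    using pos by (simp add: d_def norm_divide) (simp add: x_def dist_norm norm_minus_commute)
  have qp: "q - p = of_real x * d" using pos by (simp add: d_def)
  have "r - p = of_real (z / x) * (cis \<theta> * (q - p))"
    unfolding x_def z_def by (rule tile_shape_polar [OF shape \<theta>])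
  then have rp: "r - p = of_real z * (cis \<theta> * d)"
    unfolding qp using pos by simp
  then have pr: "p - r = of_real z * (cis (2 * turn \<theta>) * d)"
    unfolding cis_2_turn by (simp add: algebra_simps)
  have rq: "r - q = (of_real z * cis \<theta> - of_real x) * d"
    using qp rp by (simp add: algebra_simps)
  have "\<exists>j. (j = 3 \<or> j = (-1::int)) \<and> r - q = - (of_real (c * s) * (cis (of_int j * turn \<theta>) * d))"
  proof (cases "x = c \<and> z = c * (1 - s\<^sup>2)")
    case True
    then have xz: "x = c" "z = c * (1 - s\<^sup>2)" by auto
    have "r - q = of_real c * (of_real (1 - s\<^sup>2) * cis \<theta> - 1) * d"
      unfolding rq xz by (simp add: algebra_simps)
    also have "of_real (1 - s\<^sup>2) * cis \<theta> - 1 = - of_real s * cis (3 * turn \<theta>)"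
      unfolding s_def by (rule cis_turn_identities)
    finally show ?thesis
      by (intro exI [of _ 3]) (simp add: mult.assoc)
  next
    case False
    then have xz: "x = c * (1 - s\<^sup>2)" "z = c"
      using shape by (auto simp: tile_shape_def x_def z_def s_def)
    have "r - q = of_real c * (cis \<theta> - of_real (1 - s\<^sup>2)) * d"
      unfolding rq xz by (simp add: algebra_simps)
    also have "cis \<theta> - of_real (1 - s\<^sup>2) = - of_real s * cis (- turn \<theta>)"
      unfolding s_def by (rule cis_turn_identities)
    finally show ?thesis
      by (intro exI [of _ "-1"]) (simp add: mult.assoc)
  qed
  then show ?thesis
    using that [OF nd _ qp _ pr pos x_def z_def] unfolding s_def by blast
qed

lemma tile_shape_vertex_angle:
  assumes shape: "tile_shape \<theta> c p q r" and \<theta>: "0 < \<theta>" "\<theta> < pi"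
    and rot: "(v, y, w) \<in> rotations p q r"
  obtains t \<omega> where "0 < t" "\<omega> \<in> {\<theta>, (pi - 3 * \<theta>) / 2, turn \<theta>}"
    "w - v = of_real t * (cis \<omega> * (y - v))"
proof -
  obtain d x z j where e: "norm d = 1" "j = 3 \<or> j = (-1::int)"
    "q - p = of_real x * d"
    "r - q = - (of_real (c * (2 * sin (\<theta> / 2))) * (cis (of_int j * turn \<theta>) * d))"
    "p - r = of_real z * (cis (2 * turn \<theta>) * d)"
    "0 < x" "0 < z" "x = dist p q" "z = dist p r"
    by (rule tile_shape_edges [OF shape \<theta>]) (rule that; assumption)
  define a where "a = c * (2 * sin (\<theta> / 2))"
  have "a = dist q r" "q \<noteq> r" using shape by (auto simp: tile_shape_def a_def orient_eq)
  then have a: "a > 0" by simp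
  have rq: "r - q = - (of_real a * (cis (of_int j * turn \<theta>) * d))" using e(4) by (simp add: a_def)
  \<comment> \<open>The angle \<beta> equals -3 times \<open>turn \<theta>\<close> up to a full
    turn.\<close>
  have ang3: "cis (- (3 * turn \<theta>)) = cis ((pi - 3 * \<theta>) / 2)"
  proof -
    have "- (3 * turn \<theta>) = (pi - 3 * \<theta>) / 2 + - (2 * pi)"
      by (simp add: turn_def field_simps)
    then have "cis (- (3 * turn \<theta>)) = cis ((pi - 3 * \<theta>) / 2 + - (2 * pi))"
      by (simp only:)
    also have "\<dots> = cis ((pi - 3 * \<theta>) / 2)"
      unfolding cis_mult [symmetric] by (simp add: complex_eq_iff)
    finally show ?thesis .
  qed
  consider "v = p" "y = q" "w = r" | "v = q" "y = r" "w = p" | "v = r" "y = p" "w = q"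
    using rot by (auto simp: rotations_def)
  then show ?thesis
  proof cases
    case 1
    have "w - v = - (p - r)" using 1 by simp
    also have "\<dots> = of_real (z / x) * (cis \<theta> * (y - v))"
      using e(6) unfolding 1 e(3) e(5) cis_2_turn by simp
    finally show ?thesis using that [of "z / x" \<theta>] e(6,7) by simp
  next
    case 2
    have "w - v = - (of_real x * d)" using e(3) 2 by (simp add: algebra_simps)
    also have "\<dots> = of_real (x / a) * (cis (- (of_int j * turn \<theta>)) * (y - v))"
    proof -
      have "cis (- (of_int j * turn \<theta>)) * (cis (of_int j * turn \<theta>) * d) = d"
        by (simp add: mult.assoc [symmetric] cis_mult)
      then show ?thesis using a unfolding 2 rq by (simp add: mult.left_commute)
    qed
    finally have "w - v = of_real (x / a) * (cis (- (of_int j * turn \<theta>)) * (y - v))" .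
    moreover have "cis (- (of_int j * turn \<theta>)) = cis ((pi - 3 * \<theta>) / 2) \<or>
        cis (- (of_int j * turn \<theta>)) = cis (turn \<theta>)"
      using e(2) ang3 by auto
    ultimately show ?thesis
      using that [of "x / a" "(pi - 3 * \<theta>) / 2"] that [of "x / a" "turn \<theta>"] a e(6) by auto
  next
    case 3
    have "w - v = of_real a * (cis (of_int j * turn \<theta>) * d)" using rq 3 by (simp add: algebra_simps)
    also have "\<dots> = of_real (a / z) * (cis (of_int (j - 2) * turn \<theta>) * (y - v))"
    proof -
      have "cis (of_int (j - 2) * turn \<theta>) * (cis (2 * turn \<theta>) * d) = cis (of_int j * turn \<theta>) * d"
        by (simp add: mult.assoc [symmetric] cis_mult algebra_simps)
      then show ?thesis using e(7) unfolding 3 e(5) by (auto simp: mult.commute mult.left_commute)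
    qed
    finally have "w - v = of_real (a / z) * (cis (of_int (j - 2) * turn \<theta>) * (y - v))" .
    moreover have "cis (of_int (j - 2) * turn \<theta>) = cis ((pi - 3 * \<theta>) / 2) \<or>
        cis (of_int (j - 2) * turn \<theta>) = cis (turn \<theta>)"
      using e(2) ang3 by auto
    ultimately show ?thesis
      using that [of "a / z" "(pi - 3 * \<theta>) / 2"] that [of "a / z" "turn \<theta>"] a e(7) by auto
  qed
qed

text \<open>After a translation the isometry fixes 0 and is therefore linear, so it maps hulls to
  hulls of the image vertices.\<close>

lemma congruent_tri:
  assumes "congruent_figures (tri P Q R) S"
  obtains p q r where "S = tri p q r" "dist p q = dist P Q" "dist q r = dist Q R" "dist p r = dist P R"
proof -
  obtain f :: "complex \<Rightarrow> complex" where f: "\<And>x y. dist (f x) (f y) = dist x y" "f ` tri P Q R = S"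
    using assms by (auto simp: congruent_figures_def)
  define g where "g = (\<lambda>x. f x - f 0)"
  have "linear g"
    by (rule isometry_linear) (simp_all add: g_def f(1) [unfolded dist_norm] dist_norm)
  have fg: "f = (\<lambda>x. f 0 + x) \<circ> g" by (auto simp: g_def)
  have "S = (\<lambda>x. f 0 + x) ` g ` (convex hull {P, Q, R})"
    unfolding f(2) [symmetric] tri_def by (subst fg) (simp add: image_comp)
  also have "\<dots> = convex hull ((\<lambda>x. f 0 + x) ` g ` {P, Q, R})"
    unfolding convex_hull_linear_image [OF \<open>linear g\<close>] convex_hull_translation ..
  also have "(\<lambda>x. f 0 + x) ` g ` {P, Q, R} = {f P, f Q, f R}"
    by (simp add: g_def)
  finally have "S = tri (f P) (f Q) (f R)" by (simp add: tri_def)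
  then show ?thesis using that f(1) by blast
qed

section \<open>Signs of the tiles\<close>

lemma tile_shape_orient:
  assumes "tile_shape \<theta> c p q r" "0 < \<theta>" "\<theta> < pi"
  shows "orient p q r = c\<^sup>2 * (1 - (2 * sin (\<theta> / 2))\<^sup>2) * sin \<theta>"
proof -
  have pq: "dist p q \<noteq> 0" using assms(1) by (auto simp: tile_shape_def orient_eq)
  define k where "k = dist p r / dist p q"
  have "orient p q r = Im (cnj (q - p) * (of_real k * (cis \<theta> * (q - p))))"
    unfolding orient_def k_def tile_shape_polar [OF assms] ..
  also have "\<dots> = k * (dist p q)\<^sup>2 * sin \<theta>"
    unfolding dist_norm cmod_power2 by (simp add: power2_eq_square algebra_simps)
  also have "k * (dist p q)\<^sup>2 = dist p q * dist p r"
    using pq by (simp add: k_def power2_eq_square)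
  also have "dist p q * dist p r = c\<^sup>2 * (1 - (2 * sin (\<theta> / 2))\<^sup>2)"
    using assms(1) unfolding tile_shape_def power2_eq_square by auto
  finally show ?thesis .
qed

lemma horizontal_part_integral:
  assumes "norm d = 1"
  obtains n :: int where "horizontal_part (cnj d * z) = of_int n * norm z"
proof (cases "Im (cnj d * z) = 0")
  case True
  have "\<bar>Re w\<bar> = norm w" if "Im w = 0" for w using that by (simp add: cmod_def)
  then have "\<bar>Re (cnj d * z)\<bar> = norm (cnj d * z)" using True by blast
  also have "\<dots> = norm z" using assms by (simp add: norm_mult)
  finally have "\<bar>Re (cnj d * z)\<bar> = norm z" .
  then have "Re (cnj d * z) = of_int 1 * norm z \<or> Re (cnj d * z) = of_int (-1) * norm z" by auto
  then show ?thesis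
    using that [of 1] that [of "-1"] True by (auto simp: horizontal_part_def)
next
  case False
  then show ?thesis using that [of 0] by (simp add: horizontal_part_def)
qed

text \<open>The bound \<open>3 * \<theta> < pi\<close> says that \<beta> is positive; it also yields
  s < 2 sin (\<pi>/6) = 1.\<close>

locale isosceles_tiling = triangle_dissection I p q r A B C
  for I :: "'i set" and p q r :: "'i \<Rightarrow> complex" and A B C :: complex +
  fixes \<theta> c X s :: real and d :: complex
  assumes \<theta>: "0 < \<theta>" "3 * \<theta> < pi"
    and c: "0 < c" and X: "0 < X" and d: "norm d = 1"
    and B: "B = A + of_real X * d" and C: "C = A + of_real X * (cis \<theta> * d)"
    and shape: "i \<in> I \<Longrightarrow> tile_shape \<theta> c (p i) (q i) (r i)"
    and s: "s = 2 * sin (\<theta> / 2)"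
begin

lemma \<theta>_less_pi: "\<theta> < pi"
  using \<theta> by simp

lemma s_bounds: "0 < s" "s < 1"
proof -
  show "0 < s" unfolding s using \<theta> by (simp add: sin_gt_zero)
  have "sin (\<theta> / 2) < sin (pi / 6)"
    using \<theta> by (intro sin_monotone_2pi) simp_all
  then show "s < 1" unfolding s by (simp add: sin_30)
qed

lemma area_relation: "X\<^sup>2 = real (card I) * (c\<^sup>2 * (1 - s\<^sup>2))"
proof -
  have "X\<^sup>2 * sin \<theta> = orient A B C"
    using orient_polar [OF d, of A X 0 X \<theta>] by (simp add: B C power2_eq_square)
  also have "\<dots> = (\<Sum>i\<in>I. c\<^sup>2 * (1 - s\<^sup>2) * sin \<theta>)"
    unfolding orient_additive s using \<theta> shape
    by (intro sum.cong tile_shape_orient) auto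
  finally have "X\<^sup>2 * sin \<theta> = real (card I) * (c\<^sup>2 * (1 - s\<^sup>2)) * sin \<theta>"
    by simp
  moreover have "sin \<theta> \<noteq> 0" using sin_gt_zero [of \<theta>] \<theta> by simp
  ultimately show ?thesis by simp
qed

text \<open>With \<open>\<phi>\<close> the signed length along \<open>d\<close>, every tile edge
  contributes its length times -1, 0 or 1, whereas on the outer boundary only \<open>AB\<close> is
  parallel to \<open>d\<close>.\<close>

lemma side_integral_combination:
  obtains x y z :: int where "X = c * (of_int x + of_int y * s + of_int z * (1 - s\<^sup>2))"
proof -
  define \<phi> where "\<phi> = (\<lambda>z. horizontal_part (cnj d * z))"
  have hom: "real_homogeneous \<phi>"
    unfolding real_homogeneous_def \<phi>_def horizontal_part_def by (auto simp: algebra_simps)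
  have "\<exists>x y z :: int. boundary_sum \<phi> (p i) (q i) (r i) =
      c * (of_int x + of_int y * s + of_int z * (1 - s\<^sup>2))" if i: "i \<in> I" for i
  proof -
    obtain n1 n2 n3 :: int where n: "\<phi> (q i - p i) = of_int n1 * norm (q i - p i)"
      "\<phi> (r i - q i) = of_int n2 * norm (r i - q i)" "\<phi> (p i - r i) = of_int n3 * norm (p i - r i)"
      unfolding \<phi>_def using horizontal_part_integral [OF d] by metis
    have sum: "boundary_sum \<phi> (p i) (q i) (r i) =
        of_int n1 * dist (p i) (q i) + of_int n2 * dist (q i) (r i) + of_int n3 * dist (p i) (r i)"
      unfolding boundary_sum_def n by (simp add: dist_norm norm_minus_commute)
    consider "dist (p i) (q i) = c" "dist (p i) (r i) = c * (1 - s\<^sup>2)"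
      | "dist (p i) (q i) = c * (1 - s\<^sup>2)" "dist (p i) (r i) = c"
      using shape [OF i] unfolding tile_shape_def s by auto
    moreover have "dist (q i) (r i) = c * s" using shape [OF i] by (simp add: tile_shape_def s)
    ultimately show ?thesis
    proof cases
      case 1
      show ?thesis
        unfolding sum 1 \<open>dist (q i) (r i) = c * s\<close>
        by (intro exI [of _ n1] exI [of _ n2] exI [of _ n3]) (simp add: algebra_simps)
    next
      case 2
      show ?thesis
        unfolding sum 2 \<open>dist (q i) (r i) = c * s\<close>
        by (intro exI [of _ n3] exI [of _ n2] exI [of _ n1]) (simp add: algebra_simps)
    qed
  qed
  then obtain x y z :: "'i \<Rightarrow> int" where xyz: "\<And>i. i \<in> I \<Longrightarrow> boundary_sum \<phi> (p i) (q i) (r i) =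
      c * (of_int (x i) + of_int (y i) * s + of_int (z i) * (1 - s\<^sup>2))"
    by metis
  have dd: "cnj d * d = 1"
    using d complex_norm_square [of d] by (simp add: mult.commute)
  have "\<phi> (B - A) = X"
  proof -
    have "cnj d * (B - A) = of_real X * (cnj d * d)" by (simp add: B)
    then show ?thesis unfolding \<phi>_def dd by (simp add: horizontal_part_def)
  qed
  moreover have "\<phi> (C - B) = 0"
  proof -
    have "cnj d * (C - B) = of_real X * (cis \<theta> - 1) * (cnj d * d)" by (simp add: B C algebra_simps)
    then show ?thesis
      unfolding \<phi>_def dd using X \<theta> sin_gt_zero [of \<theta>] by (simp add: horizontal_part_def)
  qed
  moreover have "\<phi> (A - C) = 0"
  proof -
    have "cnj d * (A - C) = - of_real X * cis \<theta> * (cnj d * d)" by (simp add: C algebra_simps)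
    then show ?thesis
      unfolding \<phi>_def dd using X \<theta> sin_gt_zero [of \<theta>] by (simp add: horizontal_part_def)
  qed
  ultimately have "X = boundary_sum \<phi> A B C" by (simp add: boundary_sum_def)
  also have "\<dots> = (\<Sum>i\<in>I. c * (of_int (x i) + of_int (y i) * s + of_int (z i) * (1 - s\<^sup>2)))"
    unfolding boundary_sum_additive [OF hom] by (intro sum.cong refl xyz)
  also have "\<dots> = c * (of_int (\<Sum>i\<in>I. x i) + of_int (\<Sum>i\<in>I. y i) * s + of_int (\<Sum>i\<in>I. z i) * (1 - s\<^sup>2))"
    by (simp add: sum_distrib_left [symmetric] sum_distrib_right sum.distrib)
  finally show ?thesis by (rule that)
qed

lemma angle_irrational:
  assumes "n \<noteq> 0"
  shows "of_int n * \<theta> \<noteq> of_int k * pi"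
proof
  assume rat: "of_int n * \<theta> = of_int k * pi"
  obtain x y z :: int where xyz: "X = c * (of_int x + of_int y * s + of_int z * (1 - s\<^sup>2))"
    by (rule side_integral_combination)
  \<comment> \<open>Its value at \<open>s\<close> is \<open>X / c\<close>, the scale factor.\<close>
  define P :: "int poly" where "P = [:x + z, y, - z:]"
  define \<phi> where "\<phi> = (pi - \<theta>) / 2"
  show False
  proof (rule no_rational_cosine)
    have "sin (\<theta> / 2) = cos (pi / 2 - \<theta> / 2)" by (simp add: cos_diff)
    then show "s = 2 * cos \<phi>" unfolding s \<phi>_def by (simp add: diff_divide_distrib)
    show "0 < s" "s < 1" by (rule s_bounds)+
    \<comment> \<open>The factor 4 compensates the halving in \<open>\<phi>\<close>: 4n\<phi> =
      2n\<pi> - 2n\<theta> = (n - k) 2\<pi>. The absolute value is allowed because cos is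
      even.\<close>
    show "0 < nat (4 * \<bar>n\<bar>)" using assms by simp
    have "real (nat (4 * \<bar>n\<bar>)) * \<phi> = 4 * \<bar>of_int n\<bar> * \<phi>" by simp
    also have "cos \<dots> = cos (4 * of_int n * \<phi>)"
      by (cases "0 \<le> n") (simp_all add: abs_if)
    also have "4 * of_int n * \<phi> = of_int (n - k) * (2 * pi)"
      using rat unfolding \<phi>_def by (simp add: field_simps)
    also have "cos \<dots> = 1" by (metis cos_int_2pin mult.commute)
    finally show "cos (real (nat (4 * \<bar>n\<bar>)) * \<phi>) = 1" .
    show "card I > 0"
    proof (rule ccontr)
      assume "\<not> 0 < card I"
      then have "X\<^sup>2 = 0" using area_relation by simp
      then show False using X by simp
    qed
    have "(of_int x + of_int y * s + of_int z * (1 - s\<^sup>2))\<^sup>2 = real (card I) * (1 - s\<^sup>2)"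
    proof -
      have "c\<^sup>2 * (of_int x + of_int y * s + of_int z * (1 - s\<^sup>2))\<^sup>2 = c\<^sup>2 * (real (card I) * (1 - s\<^sup>2))"
        using area_relation unfolding xyz power_mult_distrib by (simp add: algebra_simps)
      then show ?thesis using c by simp
    qed
    then have "of_real ((of_int x + of_int y * s + of_int z * (1 - s\<^sup>2))\<^sup>2) =
        (of_real (real (card I) * (1 - s\<^sup>2)) :: complex)" by simp
    moreover have "int_poly_eval P (of_real s) = of_real (of_int x + of_int y * s + of_int z * (1 - s\<^sup>2))"
      by (simp add: P_def int_poly_eval_pCons power2_eq_square algebra_simps)
    ultimately show "(int_poly_eval P (of_real s))\<^sup>2 = of_nat (card I) * (1 - (of_real s)\<^sup>2)"
      by simp
  qed
qed

text \<open>\<open>direction_sign\<close> is \<open>(-1) ^ n\<close> on the direction of \<open>AB\<close> turned \<open>n\<close> times by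
  \<open>\<gamma> = (\<pi> + \<theta>) / 2\<close>, is odd, and vanishes off the orbit of that direction.  All angles of the tile
  are multiples of \<open>\<gamma>\<close> modulo \<open>\<pi>\<close>, so that it is constant along the oriented boundary of each tile.\<close>

definition direction_sign_rel :: "complex \<Rightarrow> real \<Rightarrow> bool" where
  "direction_sign_rel z v \<longleftrightarrow> (\<exists>(k::real) (n::int). k \<noteq> 0 \<and> z = of_real k * (cis (of_int n * turn \<theta>) * d) \<and>
     v = sgn k * (if even n then 1 else -1))"

definition direction_sign :: "complex \<Rightarrow> real" where
  "direction_sign z = (if \<exists>v. direction_sign_rel z v then THE v. direction_sign_rel z v else 0)"

text \<open>Comparing two representations makes (n - m) \<open>turn \<theta>\<close> a multiple of
  \<pi>, hence also (n - m) \<theta>; irrationality gives n = m, and then the real factors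
  agree.\<close>

lemma direction_sign_rel_unique:
  assumes "direction_sign_rel z v" "direction_sign_rel z v'"
  shows "v = v'"
proof -
  obtain k :: real and n :: int where kn: "k \<noteq> 0" "z = of_real k * (cis (of_int n * turn \<theta>) * d)"
     "v = sgn k * (if even n then 1 else -1)"
    using assms(1) by (auto simp: direction_sign_rel_def)
  obtain l :: real and m :: int where lm: "l \<noteq> 0" "z = of_real l * (cis (of_int m * turn \<theta>) * d)"
     "v' = sgn l * (if even m then 1 else -1)"
    using assms(2) by (auto simp: direction_sign_rel_def)
  have d0: "d \<noteq> 0" using d by auto
  have eq: "of_real k * cis (of_int n * turn \<theta>) = of_real l * cis (of_int m * turn \<theta>)"
    using kn(2) lm(2) d0 by simp
  have "of_real k * cis (of_int (n - m) * turn \<theta>) =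
      of_real k * cis (of_int n * turn \<theta>) * cis (- (of_int m * turn \<theta>))"
    by (simp add: mult.assoc cis_mult algebra_simps)
  also have "\<dots> = of_real l"
    unfolding eq by (simp add: mult.assoc cis_mult)
  finally have kl: "of_real k * cis (of_int (n - m) * turn \<theta>) = of_real l" .
  then have "Im (of_real k * cis (of_int (n - m) * turn \<theta>)) = 0" by simp
  then have "sin (of_int (n - m) * turn \<theta>) = 0" using kn(1) by simp
  then obtain i :: int where "of_int (n - m) * turn \<theta> = of_int i * pi"
    unfolding sin_zero_iff_int2 by blast
  then have "of_int (n - m) * \<theta> = of_int (2 * i - (n - m)) * pi"
    by (simp add: turn_def algebra_simps)
  then have "n - m = 0" using angle_irrational by blast
  then show ?thesis using kl kn(3) lm(3) by simp
qed

lemma direction_sign_eq: "direction_sign_rel z v \<Longrightarrow> direction_sign z = v"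
  unfolding direction_sign_def using direction_sign_rel_unique by auto

lemma direction_sign_rel_mult:
  assumes "direction_sign_rel z v" "k \<noteq> 0"
  shows "direction_sign_rel (of_real k * (cis (of_int m * turn \<theta>) * z))
    (sgn k * (if even m then 1 else -1) * v)"
proof -
  obtain l :: real and n :: int where ln: "l \<noteq> 0" "z = of_real l * (cis (of_int n * turn \<theta>) * d)"
     "v = sgn l * (if even n then 1 else -1)"
    using assms(1) by (auto simp: direction_sign_rel_def)
  have "cis (of_int (m + n) * turn \<theta>) = cis (of_int m * turn \<theta>) * cis (of_int n * turn \<theta>)"
    by (simp add: cis_mult algebra_simps)
  then have "of_real k * (cis (of_int m * turn \<theta>) * z) = of_real (k * l) * (cis (of_int (m + n) * turn \<theta>) * d)"
    unfolding ln(2) by (simp add: mult_ac)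
  then show ?thesis
    unfolding direction_sign_rel_def using assms(2) ln(1,3)
    by (intro exI [of _ "k * l"] exI [of _ "m + n"]) (auto simp: sgn_mult)
qed

lemma direction_sign_mult:
  assumes "k \<noteq> 0"
  shows "direction_sign (of_real k * (cis (of_int m * turn \<theta>) * z)) =
    sgn k * (if even m then 1 else -1) * direction_sign z"
proof (cases "\<exists>v. direction_sign_rel z v")
  case True
  then obtain v where v: "direction_sign_rel z v" by blast
  show ?thesis
    unfolding direction_sign_eq [OF v] by (rule direction_sign_eq [OF direction_sign_rel_mult [OF v assms]])
next
  case False
  let ?z = "of_real k * (cis (of_int m * turn \<theta>) * z)"
  \<comment> \<open>The multiplication can be undone, so if the product lay in the orbit,
    \<open>z\<close> would too.\<close>
  have z: "of_real (1 / k) * (cis (of_int (- m) * turn \<theta>) * ?z) = z"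
  proof -
    have "cis (of_int (- m) * turn \<theta>) * cis (of_int m * turn \<theta>) = 1" by (simp add: cis_mult)
    then have "of_real (1 / k) * (cis (of_int (- m) * turn \<theta>) * ?z) = of_real (1 / k) * of_real k * z"
      by (simp add: mult_ac)
    then show ?thesis using assms by simp
  qed
  have "\<not> direction_sign_rel ?z v" for v
  proof
    assume "direction_sign_rel ?z v"
    moreover have "1 / k \<noteq> 0" using assms by simp
    ultimately have "direction_sign_rel (of_real (1 / k) * (cis (of_int (- m) * turn \<theta>) * ?z))
        (sgn (1 / k) * (if even (- m) then 1 else -1) * v)"
      by (rule direction_sign_rel_mult)
    then show False using False unfolding z by blast
  qed
  then show ?thesis using False by (simp add: direction_sign_def)
qed

lemma direction_sign_scale:
  assumes "k \<noteq> 0"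
  shows "direction_sign (of_real k * z) = sgn k * direction_sign z"
  using direction_sign_mult [OF assms, of 0 z] by simp

lemma direction_sign_base: "direction_sign d = 1"
  by (rule direction_sign_eq, unfold direction_sign_rel_def) (intro exI [of _ 1] exI [of _ 0], simp)

lemma direction_sign_cases: "direction_sign z \<in> {-1, 0, 1}"
proof (cases "\<exists>v. direction_sign_rel z v")
  case True
  then obtain v where v: "direction_sign_rel z v" by blast
  then have "v \<in> {-1, 0, 1}" by (auto simp: direction_sign_rel_def sgn_if split: if_splits)
  then show ?thesis by (simp add: direction_sign_eq [OF v])
next
  case False
  then show ?thesis by (simp add: direction_sign_def)
qed

section \<open>The sign of a tile and its propagation from the apex\<close>

definition tile_sign :: "'i \<Rightarrow> real" where
  "tile_sign i = direction_sign (q i - p i)"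

lemma tile_sign_edges:
  assumes "i \<in> I" "(x, y, z) \<in> rotations (p i) (q i) (r i)"
  shows "direction_sign (y - x) = tile_sign i"
proof -
  obtain e u w j where e: "norm e = 1" "j = 3 \<or> j = (-1::int)"
    "q i - p i = of_real u * e"
    "r i - q i = - (of_real (c * (2 * sin (\<theta> / 2))) * (cis (of_int j * turn \<theta>) * e))"
    "p i - r i = of_real w * (cis (2 * turn \<theta>) * e)"
    "0 < u" "0 < w"
    by (rule tile_shape_edges [OF shape [OF assms(1)] \<theta>(1) \<theta>_less_pi])
  have 1: "direction_sign (q i - p i) = direction_sign e"
    unfolding e(3) using e(6) by (simp add: direction_sign_scale)
  have "r i - q i = of_real (- (c * s)) * (cis (of_int j * turn \<theta>) * e)"
    unfolding e(4) s by simp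
  then have 2: "direction_sign (r i - q i) = direction_sign e"
    using direction_sign_mult [of "- (c * s)" j e] e(2) c s_bounds by (auto simp: sgn_mult)
  have 3: "direction_sign (p i - r i) = direction_sign e"
    unfolding e(5) using direction_sign_mult [of w 2 e] e(7) by simp
  show ?thesis
    using assms(2) 1 2 3 unfolding tile_sign_def rotations_def by auto
qed

text \<open>The shared segment is traversed in opposite senses by the two boundaries, and
  \<open>direction_sign\<close> is odd.\<close>

lemma tile_sign_flips:
  assumes "i \<in> I" "j \<in> I" "i \<noteq> j" "share_segment (tile i) (tile j)"
  shows "tile_sign j = - tile_sign i"
proof -
  obtain x y z x' y' z' k where e: "(x, y, z) \<in> rotations (p i) (q i) (r i)"
    "(x', y', z') \<in> rotations (p j) (q j) (r j)" "0 < k" "y' - x' = - (of_real k * (y - x))"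
    by (rule share_segment_opposite_edges [OF orient_pos [OF assms(1)] orient_pos [OF assms(2)]
          interior_disjoint [OF assms(1-3)] assms(4)])
  have "y' - x' = of_real (- k) * (y - x)" using e(4) by simp
  then have "direction_sign (y' - x') = - direction_sign (y - x)"
    using direction_sign_scale [of "- k" "y - x"] e(3) by simp
  then show ?thesis
    using tile_sign_edges [OF assms(1) e(1)] tile_sign_edges [OF assms(2) e(2)] by simp
qed

lemma sum_tile_sign: "X = c * (1 + s) * (\<Sum>i\<in>I. tile_sign i)"
proof -
  define \<phi> where "\<phi> = (\<lambda>z. norm z * direction_sign z)"
  have hom: "real_homogeneous \<phi>"
    unfolding real_homogeneous_def
  proof (intro allI)
    fix k z
    show "\<phi> (of_real k * z) = k * \<phi> z"
      by (cases "k = 0") (auto simp: \<phi>_def norm_mult direction_sign_scale abs_sgn sgn_if)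
  qed
  have tile: "boundary_sum \<phi> (p i) (q i) (r i) = (2 + s - s\<^sup>2) * c * tile_sign i" if i: "i \<in> I" for i
  proof -
    have "boundary_sum \<phi> (p i) (q i) (r i) = (dist (p i) (q i) + dist (q i) (r i) + dist (p i) (r i)) * tile_sign i"
      unfolding boundary_sum_def \<phi>_def dist_norm
      using tile_sign_edges [OF i, of "p i" "q i" "r i"] tile_sign_edges [OF i, of "q i" "r i" "p i"]
        tile_sign_edges [OF i, of "r i" "p i" "q i"]
      by (simp add: rotations_def norm_minus_commute algebra_simps)
    also have "dist (p i) (q i) + dist (q i) (r i) + dist (p i) (r i) = (2 + s - s\<^sup>2) * c"
      using shape [OF i] unfolding tile_shape_def s by (auto simp: algebra_simps)
    finally show ?thesis .
  qed
  have "\<phi> (B - A) = X"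
    using X d by (simp add: \<phi>_def B norm_mult direction_sign_scale direction_sign_base)
  moreover have "\<phi> (A - C) = X"
  proof -
    have "A - C = of_real X * (cis (of_int 2 * turn \<theta>) * d)"
      using cis_2_turn [of \<theta>] by (simp add: C)
    then show ?thesis
      using X d direction_sign_mult [of X 2 d]
      by (simp add: \<phi>_def norm_mult direction_sign_base)
  qed
  \<comment> \<open>The base is an odd power of \<open>cis (turn \<theta>)\<close> with a positive
    factor, so it counts negatively.\<close>
  moreover have "\<phi> (C - B) = - (X * s)"
  proof -
    have "cis \<theta> - 1 = of_real s * cis (turn \<theta>)"
    proof -
      define u where "u = cis (\<theta> / 2)"
      have u0: "u \<noteq> 0" by (simp add: u_def)
      have iu: "cis (- (\<theta> / 2)) = inverse u" by (simp add: u_def)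
      have su: "of_real s = - \<i> * (u - inverse u)"
        unfolding iu [symmetric] u_def s by (simp add: complex_eq_iff)
      have uu: "cis \<theta> = u * u" by (simp add: u_def cis_mult)
      show ?thesis
        unfolding cis_turn u_def [symmetric] su uu using u0 by (simp add: algebra_simps)
    qed
    then have "C - B = of_real (X * s) * (cis (of_int 1 * turn \<theta>) * d)"
      by (simp add: B C right_diff_distrib [symmetric] left_diff_distrib [symmetric] mult_ac)
        (metis left_diff_distrib mult.assoc mult.commute mult_1)
    then show ?thesis
      using X d s_bounds direction_sign_mult [of "X * s" 1 d]
      by (simp add: \<phi>_def norm_mult direction_sign_base sgn_mult)
  qed
  ultimately have "X * (2 - s) = boundary_sum \<phi> A B C"
    by (simp add: boundary_sum_def algebra_simps)
  also have "\<dots> = (\<Sum>i\<in>I. (2 + s - s\<^sup>2) * c * tile_sign i)"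
    unfolding boundary_sum_additive [OF hom] by (intro sum.cong refl tile)
  \<comment> \<open>The perimeter factor 2 + s - s^2 is (1 + s) (2 - s), and 2 - s also occurs on
    the left, where it cancels.\<close>
  also have "\<dots> = c * (1 + s) * (\<Sum>i\<in>I. tile_sign i) * (2 - s)"
    unfolding sum_distrib_left [symmetric] by (simp add: power2_eq_square algebra_simps)
  finally show ?thesis using s_bounds by simp
qed

text \<open>\<gamma> exceeds \<theta>, so each tile at \<open>A\<close> has angle \<theta> or
  \<beta> there. Were all of them \<beta>, then \<theta> would be a multiple of \<beta> and thus a
  rational multiple of \<pi>. A tile with angle \<theta> fills the corner, so it is alone and its
  first edge runs along \<open>AB\<close>.\<close>

lemma apex_tile_sign:
  assumes "i \<in> I" "A \<in> tile i"
  shows "tile_sign i = 1"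
proof -
  obtain lo hi l m where ang': "\<forall>i\<in>I. A \<in> tile i \<longrightarrow> 0 \<le> lo i \<and> lo i < hi i \<and> hi i \<le> \<theta> \<and> 0 < l i \<and> 0 < m i \<and>
      (A, A + of_real (l i) * (cis (lo i) * d), A + of_real (m i) * (cis (hi i) * d)) \<in> rotations (p i) (q i) (r i)"
    and total: "(\<Sum>i | i \<in> I \<and> A \<in> tile i. hi i - lo i) = \<theta>"
    by (rule apex_angles [OF d X X \<theta>(1) \<theta>_less_pi B C])
  note ang = ang' [rule_format]
  define K where "K = {i. i \<in> I \<and> A \<in> tile i}"
  have finK: "finite K" using finite_index by (simp add: K_def)
  have iK: "i \<in> K" using assms by (simp add: K_def)
  have angle: "hi j - lo j = \<theta> \<or> hi j - lo j = (pi - 3 * \<theta>) / 2" if "j \<in> K" for j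
  proof -
    have j: "j \<in> I" "A \<in> tile j" using that by (auto simp: K_def)
    note a = ang [OF j]
    obtain t \<omega> where t: "0 < t" "\<omega> \<in> {\<theta>, (pi - 3 * \<theta>) / 2, turn \<theta>}"
      "A + of_real (m j) * (cis (hi j) * d) - A = of_real t * (cis \<omega> * (A + of_real (l j) * (cis (lo j) * d) - A))"
      by (rule tile_shape_vertex_angle [OF shape [OF j(1)] \<theta>(1) \<theta>_less_pi]) (use a in blast, rule that)
    have d0: "d \<noteq> 0" using d by auto
    have eq: "of_real (m j) * cis (hi j) = of_real (t * l j) * cis (\<omega> + lo j)"
      using t(3) d0 by (simp add: cis_mult [symmetric] mult_ac)
    then have "norm (of_real (m j) * cis (hi j)) = norm (of_real (t * l j) * cis (\<omega> + lo j))" by simp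
    then have "m j = t * l j" using a t(1) by (simp add: norm_mult abs_mult)
    then have "cis (hi j) = cis (\<omega> + lo j)" using eq a t(1) by simp
    then have "cis (hi j) * cis (- lo j) = cis (\<omega> + lo j) * cis (- lo j)" by simp
    then have "cis (hi j - lo j) = cis \<omega>" by (simp add: cis_mult)
    moreover have "- pi < hi j - lo j" "hi j - lo j \<le> pi" using a \<theta> by linarith+
    moreover have "- pi < \<omega>" "\<omega> \<le> pi" using t(2) \<theta> by (auto simp: turn_def)
    ultimately have "hi j - lo j = \<omega>"
      using cis_Arg_unique [of "cis \<omega>" \<omega>] cis_Arg_unique [of "cis \<omega>" "hi j - lo j"]
      by (simp add: sgn_div_norm)
    moreover have "\<omega> \<noteq> turn \<theta>"
      using a \<theta> \<open>hi j - lo j = \<omega>\<close> by (auto simp: turn_def)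
    ultimately show ?thesis using t(2) by auto
  qed
  have total': "(\<Sum>j\<in>K. hi j - lo j) = \<theta>" using total by (simp add: K_def)
  have "\<exists>j\<in>K. hi j - lo j = \<theta>"
  proof (rule ccontr)
    assume "\<not> (\<exists>j\<in>K. hi j - lo j = \<theta>)"
    then have "(\<Sum>j\<in>K. hi j - lo j) = (\<Sum>j\<in>K. (pi - 3 * \<theta>) / 2)"
      using angle by (intro sum.cong) auto
    then have "\<theta> = real (card K) * ((pi - 3 * \<theta>) / 2)" using total' by simp
    then have "of_int (2 + 3 * int (card K)) * \<theta> = of_int (int (card K)) * pi"
      by (simp add: field_simps)
    moreover have "2 + 3 * int (card K) \<noteq> 0" by linarith
    ultimately show False using angle_irrational by blast
  qed
  then obtain j where j: "j \<in> K" "hi j - lo j = \<theta>" by blast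
  have "i = j"
  proof (rule ccontr)
    assume "i \<noteq> j"
    have "(\<Sum>k\<in>{i, j}. hi k - lo k) \<le> (\<Sum>k\<in>K. hi k - lo k)"
    proof (rule sum_mono2 [OF finK])
      show "{i, j} \<subseteq> K" using iK j(1) by simp
      show "0 \<le> hi k - lo k" if "k \<in> K - {i, j}" for k
        using ang [of k] that by (auto simp: K_def)
    qed
    then have "hi i - lo i \<le> 0" using total' j(2) \<open>i \<noteq> j\<close> by simp
    then show False using ang [OF assms] by simp
  qed
  then have "hi i - lo i = \<theta>" using j(2) by simp
  then have "lo i = 0" using ang [OF assms] by simp
  then have rot: "(A, A + of_real (l i) * d, A + of_real (m i) * (cis (hi i) * d)) \<in> rotations (p i) (q i) (r i)"
    and "0 < l i"
    using ang [OF assms] by simp_all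
  then show ?thesis
    using tile_sign_edges [OF assms(1) rot] by (simp add: direction_sign_scale direction_sign_base)
qed

lemma apex_tile_exists: "\<exists>i\<in>I. A \<in> tile i"
  using cover tri_vertices(1) [of A B C] by blast

text \<open>The tiles of nonzero sign include the one at the apex and are closed under sharing a
  segment, so \<open>exists_neighbour\<close> leaves none out.\<close>

lemma tile_sign_nonzero:
  assumes "i \<in> I"
  shows "tile_sign i = 1 \<or> tile_sign i = -1"
proof -
  define S where "S = {i\<in>I. tile_sign i \<noteq> 0}"
  have "S = I"
  proof (rule ccontr)
    assume "S \<noteq> I"
    moreover have "S \<noteq> {}" using apex_tile_exists apex_tile_sign by (force simp: S_def)
    moreover have "S \<subseteq> I" by (auto simp: S_def)
    ultimately obtain j k where jk: "j \<in> S" "k \<in> I - S" "share_segment (tile j) (tile k)"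
      using exists_neighbour by blast
    then have "tile_sign k = - tile_sign j" by (intro tile_sign_flips) (auto simp: S_def)
    then show False using jk by (auto simp: S_def)
  qed
  then have "tile_sign i \<noteq> 0" using assms by (auto simp: S_def)
  then show ?thesis using direction_sign_cases [of "q i - p i"] by (auto simp: tile_sign_def)
qed

text \<open>\<open>f\<close> stands for being black. Agreement with the sign starts at the apex and
  passes to every neighbour, since both sides flip there.\<close>

lemma coloring_unique:
  assumes flips: "\<And>i j. i \<in> I \<Longrightarrow> j \<in> I \<Longrightarrow> i \<noteq> j \<Longrightarrow> share_segment (tile i) (tile j) \<Longrightarrow> f i \<noteq> f j"
    and apex: "\<And>i. i \<in> I \<Longrightarrow> A \<in> tile i \<Longrightarrow> f i"
    and "i \<in> I"
  shows "f i \<longleftrightarrow> tile_sign i = 1"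
proof -
  define S where "S = {i\<in>I. f i \<longleftrightarrow> tile_sign i = 1}"
  have "S = I"
  proof (rule ccontr)
    assume "S \<noteq> I"
    moreover have "S \<noteq> {}" using apex_tile_exists apex_tile_sign apex by (force simp: S_def)
    moreover have "S \<subseteq> I" by (auto simp: S_def)
    ultimately obtain j k where jk: "j \<in> S" "k \<in> I - S" "share_segment (tile j) (tile k)"
      using exists_neighbour by blast
    then have "j \<noteq> k" by auto
    with jk have "tile_sign k = - tile_sign j" "f j \<noteq> f k"
      using tile_sign_flips [of j k] flips [of j k] by (auto simp: S_def)
    then show False using jk tile_sign_nonzero [of j] tile_sign_nonzero [of k] by (auto simp: S_def)
  qed
  then show ?thesis using assms(3) by (auto simp: S_def)
qed

end

section \<open>The coloring number\<close>

lemma vertex_angle_cos: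
  "dist q p * dist q r * cos (vertex_angle p q r) = ((dist q p)\<^sup>2 + (dist q r)\<^sup>2 - (dist p r)\<^sup>2) / 2"
proof -
  have inner: "(p - q) \<bullet> (r - q) = ((dist q p)\<^sup>2 + (dist q r)\<^sup>2 - (dist p r)\<^sup>2) / 2"
    unfolding dist_norm power2_norm_eq_inner by (simp add: inner_diff inner_commute algebra_simps)
  show ?thesis
  proof (cases "p = q \<or> r = q")
    case True
    then show ?thesis by (auto simp: dist_commute)
  next
    case False
    let ?n = "norm (p - q) * norm (r - q)"
    have n: "?n > 0" using False by simp
    have "\<bar>(p - q) \<bullet> (r - q)\<bar> \<le> ?n" by (rule Cauchy_Schwarz_ineq2)
    then have "\<bar>(p - q) \<bullet> (r - q) / ?n\<bar> \<le> 1" using n by (simp add: abs_divide)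
    then have "cos (vertex_angle p q r) = (p - q) \<bullet> (r - q) / ?n"
      unfolding vertex_angle_def by (rule cos_arccos_abs)
    then have "?n * cos (vertex_angle p q r) = (p - q) \<bullet> (r - q)" using n by simp
    then show ?thesis unfolding inner by (simp add: dist_norm norm_minus_commute)
  qed
qed

lemma vertex_angle_bounds:
  assumes "p \<noteq> q" "r \<noteq> q"
  shows "0 \<le> vertex_angle p q r" "vertex_angle p q r \<le> pi"
proof -
  let ?n = "norm (p - q) * norm (r - q)"
  have n: "?n > 0" using assms by simp
  have "\<bar>(p - q) \<bullet> (r - q)\<bar> \<le> ?n" by (rule Cauchy_Schwarz_ineq2)
  then have "\<bar>(p - q) \<bullet> (r - q) / ?n\<bar> \<le> 1" using n by (simp add: abs_divide)
  then have "-1 \<le> (p - q) \<bullet> (r - q) / ?n" "(p - q) \<bullet> (r - q) / ?n \<le> 1" by linarith+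
  then show "0 \<le> vertex_angle p q r" "vertex_angle p q r \<le> pi"
    unfolding vertex_angle_def by (rule arccos_lbound, rule arccos_ubound)
qed

lemma vertex_angle_sin:
  assumes "p \<noteq> q" "r \<noteq> q"
  shows "dist q p * dist q r * sin (vertex_angle p q r) = \<bar>orient q p r\<bar>"
proof (rule power2_eq_imp_eq)
  have "(dist q p * dist q r * sin (vertex_angle p q r))\<^sup>2
      = (dist q p)\<^sup>2 * (dist q r)\<^sup>2 - (dist q p * dist q r * cos (vertex_angle p q r))\<^sup>2"
    unfolding power_mult_distrib sin_squared_eq by (simp add: algebra_simps)
  also have "\<dots> = \<bar>orient q p r\<bar>\<^sup>2"
    unfolding vertex_angle_cos power2_abs orient_square ..
  finally show "(dist q p * dist q r * sin (vertex_angle p q r))\<^sup>2 = \<bar>orient q p r\<bar>\<^sup>2" .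
  show "0 \<le> dist q p * dist q r * sin (vertex_angle p q r)"
    using vertex_angle_bounds [OF assms] by (simp add: sin_ge_zero)
qed simp

text \<open>The law of sines and the projection formula for \<open>PQ\<close>, written in h =
  \<alpha>/2: since \<beta> = \<pi>/2 - 3h, its sine and cosine become cos 3h and sin 3h.\<close>

lemma tile_angles_sides:
  assumes "orient P Q R \<noteq> 0"
    and \<alpha>: "\<alpha> = vertex_angle Q P R" and \<beta>: "\<beta> = vertex_angle P Q R"
    and rel: "3 * \<alpha> + 2 * \<beta> = pi"
  shows "0 < \<alpha>" "3 * \<alpha> < pi" "dist Q R = dist P Q * (2 * sin (\<alpha> / 2))"
    "dist P R = dist P Q * (1 - (2 * sin (\<alpha> / 2))\<^sup>2)"
proof -
  have ne: "P \<noteq> Q" "Q \<noteq> R" "P \<noteq> R" using assms(1) by (auto simp: orient_eq)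
  have "0 < dist P Q * dist P R * sin \<alpha>"
    using assms(1) ne vertex_angle_sin [of Q P R] by (simp add: \<alpha>)
  then have sin\<alpha>: "0 < sin \<alpha>" by (rule zero_less_mult_pos) (use ne in simp)
  have D: "orient Q P R = - orient P Q R" by (simp add: orient_eq algebra_simps)
  have "0 < dist P Q * dist Q R * sin \<beta>"
    using assms(1) ne vertex_angle_sin [of P Q R] by (simp add: \<beta> D dist_commute)
  then have sin\<beta>: "0 < sin \<beta>" by (rule zero_less_mult_pos) (use ne in simp)
  have bounds: "0 \<le> \<alpha>" "0 \<le> \<beta>"
    unfolding \<alpha> \<beta> using ne by (auto intro: vertex_angle_bounds)
  show "0 < \<alpha>" using bounds(1) sin\<alpha> by (cases "\<alpha> = 0") auto
  have "0 < \<beta>" using bounds(2) sin\<beta> by (cases "\<beta> = 0") auto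
  then show \<alpha>_less: "3 * \<alpha> < pi" using rel by simp
  have \<beta>': "\<beta> = pi / 2 - 3 * \<alpha> / 2" using rel by simp
  have law: "dist P R * sin \<alpha> = dist Q R * sin \<beta>"
  proof -
    have "dist P Q * (dist P R * sin \<alpha>) = dist P Q * (dist Q R * sin \<beta>)"
      using vertex_angle_sin [of Q P R] vertex_angle_sin [of P Q R] ne
      by (simp add: \<alpha> \<beta> D dist_commute mult.assoc)
    then show ?thesis using ne by simp
  qed
  have proj: "dist P Q = dist P R * cos \<alpha> + dist Q R * cos \<beta>"
  proof -
    have "dist P Q * (dist P R * cos \<alpha> + dist Q R * cos \<beta>) = dist P Q * dist P Q"
      using vertex_angle_cos [of P Q R] vertex_angle_cos [of Q P R]
      by (simp add: \<alpha> \<beta> dist_commute distrib_left mult.assoc power2_eq_square field_simps)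
    then show ?thesis using ne by simp
  qed
  define h where "h = \<alpha> / 2"
  have \<alpha>h: "\<alpha> = 2 * h" by (simp add: h_def)
  have h: "0 < cos h" "sin h \<noteq> 0" 
  proof -
    show "0 < cos h" using \<open>0 < \<alpha>\<close> \<alpha>_less by (intro cos_gt_zero) (auto simp: h_def)
    show "sin h \<noteq> 0" using sin\<alpha> unfolding \<alpha>h sin_double by auto
  qed
  have s\<beta>: "sin \<beta> = cos (3 * h)" "cos \<beta> = sin (3 * h)"
    unfolding \<beta>' h_def by (simp_all add: sin_diff cos_diff)
  \<comment> \<open>Multiplying by sin \<alpha> lets the law of sines eliminate
    \<open>dist P R\<close>; what remains is cos (3h - 2h).\<close>
  have "dist P Q * sin \<alpha> = dist P R * sin \<alpha> * cos \<alpha> + dist Q R * sin (3 * h) * sin \<alpha>"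
    using proj s\<beta> by (simp add: algebra_simps)
  also have "\<dots> = dist Q R * (cos (3 * h) * cos \<alpha> + sin (3 * h) * sin \<alpha>)"
    unfolding law s\<beta> by (simp add: algebra_simps)
  also have "cos (3 * h) * cos \<alpha> + sin (3 * h) * sin \<alpha> = cos h"
    using cos_diff [of "3 * h" "2 * h"] by (simp add: \<alpha>h)
  finally have "dist P Q * (2 * sin h) * cos h = dist Q R * cos h"
    unfolding \<alpha>h sin_double by (simp add: algebra_simps)
  then show QR: "dist Q R = dist P Q * (2 * sin (\<alpha> / 2))"
    using h unfolding h_def by simp
  have "cos (3 * h) = cos h * (1 - (2 * sin h)\<^sup>2)"
  proof -
    have "cos (3 * h) = cos (2 * h + h)" by simp
    also have "\<dots> = (1 - 2 * (sin h)\<^sup>2) * cos h - 2 * sin h * cos h * sin h"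
      unfolding cos_add cos_double_sin sin_double ..
    also have "\<dots> = cos h * (1 - (2 * sin h)\<^sup>2)"
      by (simp add: power2_eq_square algebra_simps)
    finally show ?thesis .
  qed
  then have "dist P R * (2 * sin h * cos h) = dist P Q * (2 * sin h) * (cos h * (1 - (2 * sin h)\<^sup>2))"
    using law unfolding s\<beta> \<alpha>h sin_double QR h_def [symmetric] by simp
  then have "(2 * sin h * cos h) * dist P R = (2 * sin h * cos h) * (dist P Q * (1 - (2 * sin h)\<^sup>2))"
    by (simp only: mult_ac)
  then show "dist P R = dist P Q * (1 - (2 * sin (\<alpha> / 2))\<^sup>2)"
    using h unfolding h_def by simp
qed

text \<open>The base angle yields the base, 2 sin (\<alpha>/2) times the equal side, and the law of
  cosines turns this into the apex angle.\<close>

lemma isosceles_polar: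
  assumes "orient A B C > 0" "dist A B = dist A C" "0 < \<alpha>" "\<alpha> < pi"
    and angle: "vertex_angle A B C = (pi - \<alpha>) / 2"
  shows "C - A = cis \<alpha> * (B - A)"
proof -
  have ne: "A \<noteq> B" "B \<noteq> C" "A \<noteq> C" using assms(1) by (auto simp: orient_eq)
  have "dist B A * dist B C * cos ((pi - \<alpha>) / 2) = (dist B C)\<^sup>2 / 2"
    using vertex_angle_cos [of B A C] assms(2) unfolding angle by (simp add: dist_commute)
  moreover have "cos ((pi - \<alpha>) / 2) = sin (\<alpha> / 2)"
    by (simp add: diff_divide_distrib cos_diff)
  ultimately have BC: "dist B C = dist A B * (2 * sin (\<alpha> / 2))"
    using ne by (simp add: power2_eq_square dist_commute field_simps)
  have "C - A = of_real (dist A C / dist A B) * (cis \<alpha> * (B - A))"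
  proof (rule polar_of_law_of_cosines)
    show "(dist B C)\<^sup>2 = (dist A B)\<^sup>2 + (dist A C)\<^sup>2 - 2 * dist A B * dist A C * cos \<alpha>"
      unfolding BC assms(2) cos_eq_half_sin by (simp add: power2_eq_square algebra_simps)
  qed (use assms in auto)
  then show ?thesis using ne assms(2) by simp
qed

text \<open>A clockwise copy is made counterclockwise by exchanging the two vertices other than the
  one with angle \<alpha>, which is why \<open>tile_shape\<close> has two alternatives. Packing the
  vertices into one triple allows a single choice function later.\<close>

lemma tile_representative:
  assumes "orient P Q R \<noteq> 0" "congruent_figures (tri P Q R) t"
    and "dist Q R = c * (2 * sin (\<alpha> / 2))" "dist P Q = c" "dist P R = c * (1 - (2 * sin (\<alpha> / 2))\<^sup>2)"
  shows "\<exists>v. t = tri (fst v) (fst (snd v)) (snd (snd v)) \<and>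
    tile_shape \<alpha> c (fst v) (fst (snd v)) (snd (snd v))"
proof -
  obtain p q r where t: "t = tri p q r" "dist p q = dist P Q" "dist q r = dist Q R" "dist p r = dist P R"
    using congruent_tri [OF assms(2)] by blast
  have "(orient p q r)\<^sup>2 = (orient P Q R)\<^sup>2"
    unfolding orient_square t ..
  then have "orient p q r \<noteq> 0" using assms(1) by auto
  then consider "orient p q r > 0" | "orient p r q > 0"
    using orient_swap [of p q r] by linarith
  then show ?thesis
  proof cases
    case 1
    then show ?thesis
      using t assms(3-5) by (intro exI [of _ "(p, q, r)"]) (simp add: tile_shape_def)
  next
    case 2
    then show ?thesis
      using t assms(3-5)
      by (intro exI [of _ "(p, r, q)"]) (simp add: tile_shape_def tri_swap dist_commute)
  qed
qed

lemma coloring_number_formula: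
  fixes N :: nat and M X c s \<mu> :: real
  assumes "X\<^sup>2 = real N * (c\<^sup>2 * (1 - s\<^sup>2))" "X = c * (1 + s) * M" "X = \<mu> * c"
    and "0 < s" "s < 1" "0 < c" "0 < X"
  shows "real N / M\<^sup>2 = (1 + s) / (1 - s) \<and> s = (real N - M\<^sup>2) / (real N + M\<^sup>2) \<and> \<mu> = M * (1 + s)"
proof -
  have M: "M \<noteq> 0" using assms(2,7) by auto
  have "c\<^sup>2 * (1 + s) * (M\<^sup>2 * (1 + s)) = c\<^sup>2 * (1 + s) * (real N * (1 - s))"
    using assms(1) unfolding assms(2) by (simp add: power2_eq_square algebra_simps)
  then have key: "M\<^sup>2 * (1 + s) = real N * (1 - s)" using assms(4,6) by simp
  have 1: "real N / M\<^sup>2 = (1 + s) / (1 - s)"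
    using key M assms(5) by (simp add: field_simps)
  have pos: "real N + M\<^sup>2 > 0" using M by (simp add: add_nonneg_pos)
  have "s * (real N + M\<^sup>2) = real N - M\<^sup>2"
    using key by (simp add: algebra_simps)
  then have 2: "s = (real N - M\<^sup>2) / (real N + M\<^sup>2)" using pos by (simp add: field_simps)
  have "\<mu> = M * (1 + s)" using assms(2,3,6) by simp
  then show ?thesis using 1 2 by blast
qed

text \<open>The tiles serve as their own indices. Positive sign as black gives existence; conversely
  every coloring agrees with the signs, so its coloring number is their sum.\<close>

lemma isosceles_tiling_coloring:
  assumes tiling: "isosceles_tiling \<T> p q r A B C \<theta> c X s d"
    and tri: "\<And>t. t \<in> \<T> \<Longrightarrow> t = tri (p t) (q t) (r t)"
    and "X = \<mu> * c" "N = card \<T>"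
  shows "(\<exists>col. tile_coloring A \<T> col) \<and>
         (\<forall>col M. tile_coloring A \<T> col \<and> M = real_of_int (coloring_number \<T> col) \<longrightarrow>
            real N / M\<^sup>2 = (1 + s) / (1 - s) \<and>
            s = (real N - M\<^sup>2) / (real N + M\<^sup>2) \<and>
            \<mu> = M * (1 + s))"
proof -
  interpret isosceles_tiling \<T> p q r A B C \<theta> c X s d by (rule tiling)
  define col0 where "col0 = (\<lambda>t. if tile_sign t = 1 then Black else White)"
  have "tile_coloring A \<T> col0"
    unfolding tile_coloring_def
  proof (intro conjI ballI impI)
    fix t u assume tu: "t \<in> \<T>" "u \<in> \<T>" "t \<noteq> u \<and> share_segment t u"
    then have "tile_sign u = - tile_sign t"
      using tile_sign_flips [of t u] tri by metis
    then show "col0 t \<noteq> col0 u"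
      using tile_sign_nonzero [OF tu(1)] by (auto simp: col0_def)
  next
    fix t assume "t \<in> \<T>" "A \<in> t"
    then show "col0 t = Black" using apex_tile_sign [of t] tri by (simp add: col0_def)
  qed
  moreover have "real N / M\<^sup>2 = (1 + s) / (1 - s) \<and> s = (real N - M\<^sup>2) / (real N + M\<^sup>2) \<and> \<mu> = M * (1 + s)"
    if col: "tile_coloring A \<T> col" and M: "M = real_of_int (coloring_number \<T> col)" for col M
  proof -
    have black: "col t = Black \<longleftrightarrow> tile_sign t = 1" if "t \<in> \<T>" for t
    proof (rule coloring_unique [OF _ _ that])
      show "(col i = Black) \<noteq> (col j = Black)"
        if "i \<in> \<T>" "j \<in> \<T>" "i \<noteq> j" "share_segment (tile i) (tile j)" for i j
        using col that tri unfolding tile_coloring_def by (metis color.exhaust)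
      show "col i = Black" if "i \<in> \<T>" "A \<in> tile i" for i
        using col that tri unfolding tile_coloring_def by metis
    qed
    have "(\<Sum>t\<in>\<T>. tile_sign t) = (\<Sum>t\<in>\<T>. (if col t = Black then 1 else 0) - (if col t = White then 1 else 0))"
    proof (rule sum.cong [OF refl])
      fix t assume t: "t \<in> \<T>"
      show "tile_sign t = (if col t = Black then 1 else 0) - (if col t = White then 1 else 0)"
        using black [OF t] tile_sign_nonzero [OF t] by (cases "col t") auto
    qed
    also have "\<dots> = M"
      using finite_index unfolding M coloring_number_def sum_subtractf
      by (simp add: sum.If_cases Int_def)
    finally have "X = c * (1 + s) * M" using sum_tile_sign by simp
    then show ?thesis
      using area_relation assms(3,4) s_bounds c X
      by (intro coloring_number_formula [where X = X and c = c]) simp_all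
  qed
  ultimately show ?thesis by blast
qed

theorem theorem17:
  fixes A B C P Q R :: complex
    and a b c \<alpha> \<beta> \<gamma> s \<mu> :: real
    and N :: nat
    and \<T> :: "complex set set"
  assumes tile: "\<not> collinear {P, Q, R}"
    and sides: "a = dist Q R" "b = dist P R" "c = dist P Q"
    and angles: "\<alpha> = vertex_angle Q P R" "\<beta> = vertex_angle P Q R" "\<gamma> = vertex_angle P R Q"
    and angle_relation: "3 * \<alpha> + 2 * \<beta> = pi"
    and triangle: "\<not> collinear {A, B, C}"
    and isosceles: "dist A B = dist A C"
    and base_angles: "vertex_angle A B C = \<alpha> + \<beta>" "vertex_angle A C B = \<alpha> + \<beta>"
    and alpha_neq: "\<alpha> \<noteq> pi / 8"
    and tiling: "N_tiling N (convex hull {A, B, C}) (convex hull {P, Q, R}) \<T>"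
    and s_def: "s = a / c"
    and scale_factor: "dist A B = \<mu> * c"
  shows "(\<exists>col. tile_coloring A \<T> col) \<and>
         (\<forall>col M. tile_coloring A \<T> col \<and> M = real_of_int (coloring_number \<T> col) \<longrightarrow>
            real N / M\<^sup>2 = (1 + s) / (1 - s) \<and>
            s = (real N - M\<^sup>2) / (real N + M\<^sup>2) \<and>
            \<mu> = M * (1 + s))"
proof -
  have tile_orient: "orient P Q R \<noteq> 0" using tile orient_zero_collinear by blast
  note shape = tile_angles_sides [OF tile_orient angles(1,2) angle_relation]
  have \<alpha>: "0 < \<alpha>" "3 * \<alpha> < pi" "\<alpha> < pi" using shape(1,2) by auto
  have c: "0 < c" using tile_orient by (auto simp: sides orient_eq)
  have s: "s = 2 * sin (\<alpha> / 2)" using shape(3) c by (simp add: s_def sides)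
  have half: "\<alpha> + \<beta> = (pi - \<alpha>) / 2" using angle_relation by simp
  \<comment> \<open>Stated for \<open>B'\<close> and \<open>C'\<close> so that a clockwise triangle
    is covered by exchanging \<open>B\<close> and \<open>C\<close>, which changes neither the apex
    nor the tiles.\<close>
  have main: ?thesis
    if pos: "orient A B' C' > 0" and eq: "dist A B' = dist A C'" and X: "dist A B' = \<mu> * c"
      and angle: "vertex_angle A B' C' = (pi - \<alpha>) / 2"
      and tiling': "N_tiling N (tri A B' C') (tri P Q R) \<T>" for B' C'
  proof -
    define d where "d = sgn (B' - A)"
    have ne: "A \<noteq> B'" using pos by (auto simp: orient_eq)
    have tiles: "finite \<T>" "card \<T> = N" "\<And>t. t \<in> \<T> \<Longrightarrow> congruent_figures (tri P Q R) t"
      "\<Union>\<T> = tri A B' C'" "\<And>t u. t \<in> \<T> \<Longrightarrow> u \<in> \<T> \<Longrightarrow> t \<noteq> u \<Longrightarrow> t \<inter> u \<subseteq> frontier t \<inter> frontier u"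
      using tiling' by (simp_all add: N_tiling_def)
    have "\<exists>v. t = tri (fst v) (fst (snd v)) (snd (snd v)) \<and>
        tile_shape \<alpha> c (fst v) (fst (snd v)) (snd (snd v))" if "t \<in> \<T>" for t
      using tile_representative [OF tile_orient tiles(3) [OF that]] shape(3,4) sides(3) by simp
    then obtain v where v: "\<And>t. t \<in> \<T> \<Longrightarrow> t = tri (fst (v t)) (fst (snd (v t))) (snd (snd (v t)))"
      "\<And>t. t \<in> \<T> \<Longrightarrow> tile_shape \<alpha> c (fst (v t)) (fst (snd (v t))) (snd (snd (v t)))"
      by metis
    define p where "p = (\<lambda>t. fst (v t))"
    define q where "q = (\<lambda>t. fst (snd (v t)))"
    define r where "r = (\<lambda>t. snd (snd (v t)))"
    have pqr: "t = tri (p t) (q t) (r t)" "tile_shape \<alpha> c (p t) (q t) (r t)" if "t \<in> \<T>" for t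
      using v [OF that] by (simp_all add: p_def q_def r_def)
    have "isosceles_tiling \<T> p q r A B' C' \<alpha> c (dist A B') s d"
    proof
      show "finite \<T>" by (rule tiles(1))
      show "0 < orient (p t) (q t) (r t)" if "t \<in> \<T>" for t
        using pqr(2) [OF that] by (simp add: tile_shape_def)
      show "0 < orient A B' C'" by (rule pos)
      show "(\<Union>t\<in>\<T>. tri (p t) (q t) (r t)) = tri A B' C'"
        using pqr(1) tiles(4) by auto
      show "tri (p t) (q t) (r t) \<inter> tri (p u) (q u) (r u) \<subseteq> frontier (tri (p t) (q t) (r t))"
        if "t \<in> \<T>" "u \<in> \<T>" "t \<noteq> u" for t u
        using tiles(5) [OF that] pqr(1) [OF that(1)] pqr(1) [OF that(2)] by auto
      show "0 < \<alpha>" "3 * \<alpha> < pi" "0 < c" by (rule \<alpha> c)+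
      show "0 < dist A B'" using ne by simp
      show "norm d = 1" using ne by (simp add: d_def norm_sgn)
      have d: "B' - A = of_real (dist A B') * d"
        using ne by (simp add: d_def sgn_div_norm scaleR_conv_of_real dist_norm norm_minus_commute)
      then show "B' = A + of_real (dist A B') * d" by (simp add: algebra_simps)
      have "C' - A = cis \<alpha> * (B' - A)"
        by (rule isosceles_polar [OF pos eq \<alpha>(1,3) angle])
      then have "C' - A = of_real (dist A B') * (cis \<alpha> * d)"
        unfolding d by (simp add: mult.left_commute)
      then show "C' = A + of_real (dist A B') * (cis \<alpha> * d)" by (simp add: algebra_simps)
      show "tile_shape \<alpha> c (p t) (q t) (r t)" if "t \<in> \<T>" for t by (rule pqr(2) [OF that])
      show "s = 2 * sin (\<alpha> / 2)" by (rule s)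
    qed
    then show ?thesis
      by (rule isosceles_tiling_coloring) (use pqr(1) X tiles(2) in auto)
  qed
  have "orient A B C \<noteq> 0" using triangle orient_zero_collinear by blast
  then consider "orient A B C > 0" | "orient A C B > 0"
    using orient_swap [of A B C] by linarith
  then show ?thesis
  proof cases
    case 1
    then show ?thesis
      by (rule main) (use isosceles scale_factor base_angles half tiling in \<open>simp_all add: tri_def\<close>)
  next
    case 2
    then show ?thesis
      by (rule main) (use isosceles scale_factor base_angles half tiling in
        \<open>simp_all add: tri_def insert_commute\<close>)
  qed
qed

end
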